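(* Let $\Sigma\subset[0,\infty)$ be an additive semigroup with $0\in\Sigma$. Then all Čech cohomology groups $H^m(M(AP_\Sigma),\mathbb{Z})$, $m\geq 1$, of the maximal ideal space $M(AP_\Sigma)$ are trivial.
   Context: The algebra $AP$ of (uniformly) almost periodic functions is the smallest closed subalgebra of $L^\infty(\mathbb{R})$ (complex-valued, sup norm) containing all functions $e_\lambda(x):=e^{i\lambda x}$, $\lambda\in\mathbb{R}$. An almost periodic polynomial is a finite sum $\sum_j r_j e_{\lambda_j}$ with $r_j\in\mathbb{C}$, $\lambda_j\in\mathbb{R}$; the set of these is $AP^0$. The Bohr-Fourier spectrum of $a\in AP$ is $\Omega(a):=\{\lambda\in\mathbb{R} : \lim_{N\to\infty}\frac{1}{2N}\int_{-N}^{N}a(x)e_{-\lambda}(x)\,dx\neq 0\}$. A set $\Sigma\subset[0,\infty)$ is an additive semigroup if $\lambda,\mu\in\Sigma$ implies $\lambda+\mu\in\Sigma$. For such $\Sigma$ with $0\in\Sigma$, put $AP_\Sigma^0:=\{a\in AP^0 : \Omega(a)\subset\Sigma\}$ and let $AP_\Sigma$ be the closure of $AP_\Sigma^0$ in $AP$; it is a unital commutative Banach algebra (and equals $\{a\in AP:\Omega(a)\subset\Sigma\}$). $M(AP_\Sigma)$ denotes the set of nonzero algebra homomorphisms $AP_\Sigma\to\mathbb{C}$ equipped with the weak$^*$ (Gelfand) topology. *)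

theory Defs
  imports "HOL-Analysis.Analysis" "HOL-Algebra.Product_Groups"
begin

section \<open>Almost periodic functions\<close>

text \<open>The algebra of bounded continuous functions with the supremum norm is a closed subalgebra of
  \<open>L\<^sup>\<infinity>(\<real>)\<close> that contains all exponentials, so closed subalgebras generated
  by exponentials may be formed inside it.\<close>

definition bc_mult :: "(real \<Rightarrow>\<^sub>C complex) \<Rightarrow> (real \<Rightarrow>\<^sub>C complex) \<Rightarrow> (real \<Rightarrow>\<^sub>C complex)"
  where "bc_mult f g = Bcontfun (\<lambda>x. apply_bcontfun f x * apply_bcontfun g x)"

definition bc_scale :: "complex \<Rightarrow> (real \<Rightarrow>\<^sub>C complex) \<Rightarrow> (real \<Rightarrow>\<^sub>C complex)"
  where "bc_scale c f = Bcontfun (\<lambda>x. c * apply_bcontfun f x)"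

definition ap_exp :: "real \<Rightarrow> (real \<Rightarrow>\<^sub>C complex)"
  where "ap_exp l = Bcontfun (\<lambda>x. exp (\<i> * complex_of_real l * complex_of_real x))"

lemma apply_bc_mult [simp]: "apply_bcontfun (bc_mult f g) x = apply_bcontfun f x * apply_bcontfun g x"
proof -
  obtain B where B: "\<And>x. norm (apply_bcontfun f x) \<le> B"
    using bounded_apply_bcontfun[of f] by (auto simp: bounded_iff)
  obtain C where C: "\<And>x. norm (apply_bcontfun g x) \<le> C"
    using bounded_apply_bcontfun[of g] by (auto simp: bounded_iff)
  have "norm (apply_bcontfun f x * apply_bcontfun g x) \<le> B * C" for x
    unfolding norm_mult using B[of x] C[of x]
    by (intro mult_mono) (auto intro: order_trans[OF norm_ge_zero])
  then have "(\<lambda>x. apply_bcontfun f x * apply_bcontfun g x) \<in> bcontfun"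
    by (auto simp: bcontfun_def bounded_iff intro!: continuous_intros)
  then show ?thesis
    by (simp add: bc_mult_def Bcontfun_inverse)
qed

lemma apply_bc_scale [simp]: "apply_bcontfun (bc_scale c f) x = c * apply_bcontfun f x"
proof -
  have "bc_scale c f = bc_mult (Bcontfun (\<lambda>_. c)) f"
    by (simp add: bc_scale_def bc_mult_def Bcontfun_inverse const_bcontfun)
  then show ?thesis
    by (simp add: Bcontfun_inverse const_bcontfun)
qed

lemma apply_ap_exp [simp]: "apply_bcontfun (ap_exp l) x = exp (\<i> * complex_of_real l * complex_of_real x)"
proof -
  have "(\<lambda>x. exp (\<i> * complex_of_real l * complex_of_real x)) \<in> bcontfun"
    by (auto simp: bcontfun_def bounded_iff norm_exp_eq_Re intro!: continuous_intros exI[of _ 1])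
  then show ?thesis
    by (simp add: ap_exp_def Bcontfun_inverse)
qed

definition closed_subalgebra :: "(real \<Rightarrow>\<^sub>C complex) set \<Rightarrow> bool"
  where "closed_subalgebra S \<longleftrightarrow> closed S \<and> 0 \<in> S \<and>
    (\<forall>a\<in>S. \<forall>b\<in>S. a + b \<in> S) \<and>
    (\<forall>c. \<forall>a\<in>S. bc_scale c a \<in> S) \<and>
    (\<forall>a\<in>S. \<forall>b\<in>S. bc_mult a b \<in> S)"

definition AP :: "(real \<Rightarrow>\<^sub>C complex) set"
  where "AP = \<Inter>{S. closed_subalgebra S \<and> range ap_exp \<subseteq> S}"

definition AP0 :: "(real \<Rightarrow>\<^sub>C complex) set"
  where "AP0 = {a. \<exists>(n::nat) (r :: nat \<Rightarrow> complex) (l :: nat \<Rightarrow> real).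
                     a = (\<Sum>j<n. bc_scale (r j) (ap_exp (l j)))}"

definition bohr_spectrum :: "(real \<Rightarrow>\<^sub>C complex) \<Rightarrow> real set" (\<open>\<Omega>\<close>)
  where "\<Omega> a = {\<mu>. \<exists>z. z \<noteq> 0 \<and>
    ((\<lambda>N::real. complex_of_real (1 / (2 * N)) *
        integral {-N..N} (\<lambda>x. apply_bcontfun a x * apply_bcontfun (ap_exp (-\<mu>)) x)) \<longlongrightarrow> z) at_top}"

definition AP0_semi :: "real set \<Rightarrow> (real \<Rightarrow>\<^sub>C complex) set"
  where "AP0_semi \<Sigma> = {a \<in> AP0. \<Omega> a \<subseteq> \<Sigma>}"

definition AP_semi :: "real set \<Rightarrow> (real \<Rightarrow>\<^sub>C complex) set"
  where "AP_semi \<Sigma> = AP \<inter> closure (AP0_semi \<Sigma>)"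

section \<open>Maximal ideal space\<close>

text \<open>Homomorphisms are represented by functions that are \<^const>\<open>undefined\<close> outside of \<open>A\<close>,
  so that distinct elements differ somewhere on \<open>A\<close>.\<close>

definition nonzero_characters :: "(real \<Rightarrow>\<^sub>C complex) set \<Rightarrow> ((real \<Rightarrow>\<^sub>C complex) \<Rightarrow> complex) set"
  where "nonzero_characters A = {\<phi> \<in> extensional A.
    (\<forall>a\<in>A. \<forall>b\<in>A. \<phi> (a + b) = \<phi> a + \<phi> b) \<and>
    (\<forall>c. \<forall>a\<in>A. \<phi> (bc_scale c a) = c * \<phi> a) \<and>
    (\<forall>a\<in>A. \<forall>b\<in>A. \<phi> (bc_mult a b) = \<phi> a * \<phi> b) \<and>
    (\<exists>a\<in>A. \<phi> a \<noteq> 0)}"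

text \<open>The weak* topology is the topology of pointwise convergence on \<open>A\<close>.\<close>

definition maximal_ideal_space :: "(real \<Rightarrow>\<^sub>C complex) set \<Rightarrow> ((real \<Rightarrow>\<^sub>C complex) \<Rightarrow> complex) topology"
  where "maximal_ideal_space A =
    subtopology (product_topology (\<lambda>_. euclidean) A) (nonzero_characters A)"

section \<open>Cech cohomology with integer coefficients\<close>

definition open_covers :: "'a topology \<Rightarrow> 'a set set set"
  where "open_covers X = {\<U>. (\<forall>U\<in>\<U>. openin X U) \<and> \<Union>\<U> = topspace X}"

text \<open>Ordered simplices of the nerve (repetitions allowed): tuples of \<open>p + 1\<close> members of the cover
  with nonempty intersection.\<close>

definition nerve_simplices :: "'a set set \<Rightarrow> nat \<Rightarrow> 'a set list set"
  where "nerve_simplices \<U> p = {s. length s = Suc p \<and> set s \<subseteq> \<U> \<and> \<Inter>(set s) \<noteq> {}}"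

definition cech_cochain_group :: "'a set set \<Rightarrow> nat \<Rightarrow> ('a set list \<Rightarrow> int) monoid"
  where "cech_cochain_group \<U> p = product_group (nerve_simplices \<U> p) (\<lambda>_. integer_group)"

definition cech_coboundary :: "'a set set \<Rightarrow> nat \<Rightarrow> ('a set list \<Rightarrow> int) \<Rightarrow> ('a set list \<Rightarrow> int)"
  where "cech_coboundary \<U> p c =
    (\<lambda>s\<in>nerve_simplices \<U> (Suc p). \<Sum>i\<le>Suc p. (-1) ^ i * c (take i s @ drop (Suc i) s))"

definition cech_cocycles :: "'a set set \<Rightarrow> nat \<Rightarrow> ('a set list \<Rightarrow> int) set"
  where "cech_cocycles \<U> p =
    kernel (cech_cochain_group \<U> p) (cech_cochain_group \<U> (Suc p)) (cech_coboundary \<U> p)"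

definition cech_coboundaries :: "'a set set \<Rightarrow> nat \<Rightarrow> ('a set list \<Rightarrow> int) set"
  where "cech_coboundaries \<U> p =
    (case p of 0 \<Rightarrow> {\<one>\<^bsub>cech_cochain_group \<U> 0\<^esub>}
     | Suc q \<Rightarrow> cech_coboundary \<U> q ` carrier (cech_cochain_group \<U> q))"

definition cover_cohomology_group :: "nat \<Rightarrow> 'a set set \<Rightarrow> ('a set list \<Rightarrow> int) set monoid"
  where "cover_cohomology_group p \<U> =
    subgroup_generated (cech_cochain_group \<U> p) (cech_cocycles \<U> p) Mod cech_coboundaries \<U> p"

definition cover_cohomology_class ::
    "nat \<Rightarrow> 'a set set \<Rightarrow> ('a set list \<Rightarrow> int) \<Rightarrow> ('a set list \<Rightarrow> int) set"
  where "cover_cohomology_class p \<U> c = cech_coboundaries \<U> p #>\<^bsub>cech_cochain_group \<U> p\<^esub> c"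

definition refinement_map :: "'a set set \<Rightarrow> 'a set set \<Rightarrow> ('a set \<Rightarrow> 'a set) \<Rightarrow> bool"
  where "refinement_map \<V> \<U> \<pi> \<longleftrightarrow> (\<forall>V\<in>\<V>. \<pi> V \<in> \<U> \<and> V \<subseteq> \<pi> V)"

definition cech_pullback ::
    "nat \<Rightarrow> 'a set set \<Rightarrow> ('a set \<Rightarrow> 'a set) \<Rightarrow> ('a set list \<Rightarrow> int) \<Rightarrow> ('a set list \<Rightarrow> int)"
  where "cech_pullback p \<V> \<pi> c = (\<lambda>s\<in>nerve_simplices \<V> p. c (map \<pi> s))"

text \<open>The direct limit of the groups \<^term>\<open>cover_cohomology_group p \<U>\<close> over all open covers,
  directed by refinement, is formed in the usual way: the direct sum modulo the subgroup generated
  by the differences between (the images of) a class and its pullback along a refinement map.\<close>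

definition cover_cohomology_sum ::
    "nat \<Rightarrow> 'a topology \<Rightarrow> ('a set set \<Rightarrow> ('a set list \<Rightarrow> int) set) monoid"
  where "cover_cohomology_sum p X = sum_group (open_covers X) (cover_cohomology_group p)"

definition cover_cohomology_incl ::
    "nat \<Rightarrow> 'a topology \<Rightarrow> 'a set set \<Rightarrow> ('a set list \<Rightarrow> int) set \<Rightarrow>
      ('a set set \<Rightarrow> ('a set list \<Rightarrow> int) set)"
  where "cover_cohomology_incl p X \<U> h =
    (\<lambda>\<V>\<in>open_covers X. if \<V> = \<U> then h else \<one>\<^bsub>cover_cohomology_group p \<V>\<^esub>)"

definition refinement_relators ::
    "nat \<Rightarrow> 'a topology \<Rightarrow> ('a set set \<Rightarrow> ('a set list \<Rightarrow> int) set) set"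
  where "refinement_relators p X =
    {cover_cohomology_incl p X \<U> (cover_cohomology_class p \<U> c)
       \<otimes>\<^bsub>cover_cohomology_sum p X\<^esub>
     inv\<^bsub>cover_cohomology_sum p X\<^esub>
       cover_cohomology_incl p X \<V> (cover_cohomology_class p \<V> (cech_pullback p \<V> \<pi> c))
     | \<U> \<V> \<pi> c. \<U> \<in> open_covers X \<and> \<V> \<in> open_covers X \<and> refinement_map \<V> \<U> \<pi> \<and>
                 c \<in> cech_cocycles \<U> p}"

definition cech_cohomology_group ::
    "nat \<Rightarrow> 'a topology \<Rightarrow> ('a set set \<Rightarrow> ('a set list \<Rightarrow> int) set) set monoid"
  where "cech_cohomology_group p X =
    cover_cohomology_sum p X Mod generate (cover_cohomology_sum p X) (refinement_relators p X)"

end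

theory Submission
  imports Defs "HOL-Complex_Analysis.Conformal_Mappings"
begin

text \<open>The maximal ideal space is compact and contractible, and Cech cohomology of a compact
  contractible space vanishes in positive degrees.

  The contraction moves a character \<open>\<phi>\<close> along the characters \<open>\<phi>\<^sub>r\<close> with
  \<open>\<phi>\<^sub>r (e\<^sub>l) = r\<^sup>l \<phi> (e\<^sub>l)\<close> for \<open>0 \<le> r \<le> 1\<close>.  At \<open>r = 1\<close> this is \<open>\<phi>\<close>.  At
  \<open>r = 0\<close> it is the mean value functional, which sends \<open>e\<^sub>0\<close> to \<open>1\<close> and all other \<open>e\<^sub>l\<close> to \<open>0\<close>
  whatever \<open>\<phi>\<close> is; it is multiplicative because nonzero elements of \<open>\<Sigma>\<close> are positive and cannot
  add up to \<open>0\<close>.  For \<open>r = exp (-t)\<close> the character \<open>\<phi>\<^sub>r\<close> is \<open>\<phi>\<close> composed with the translation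
  \<open>x \<mapsto> x + \<i> t\<close>, which makes sense because functions with nonnegative frequencies extend to the
  upper half-plane, and which does not increase the norm by a Phragmen-Lindelof argument
  (\<open>upper_half_plane_bound\<close>).  This norm bound is what lets the formula on exponentials extend to
  a character of the whole algebra (\<open>character_extension\<close>).  Characters are contractive, so the
  maximal ideal space is compact and the contraction is jointly continuous.

  On the topological side (\<open>trivial_cech_cohomology_compact_contractible\<close>), a contraction of a
  compact space is cut into finitely many short time steps.  On a fine enough refinement of a given
  cover it becomes a finite chain of contiguous vertex maps between nerves, from a refinement map to
  a constant map.  Contiguous maps are cochain homotopic by the prism operator, so every cocycle of
  positive degree becomes a coboundary on that refinement and vanishes in the direct limit.\<close>

section \<open>Alternating face sums and prisms\<close>

text \<open>The coboundary is studied on arbitrary integer functions on lists, without reference to a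
  nerve: peeling off the head of a list turns the signed sum over faces into a recursion, and the
  identities below become inductions on the list.\<close>

definition alternating_face_sum :: "('a list \<Rightarrow> int) \<Rightarrow> 'a list \<Rightarrow> int"
  where "alternating_face_sum c s = (\<Sum>i<length s. (-1) ^ i * c (take i s @ drop (Suc i) s))"

lemma alternating_face_sum_Nil [simp]: "alternating_face_sum c [] = 0"
  by (simp add: alternating_face_sum_def)

lemma alternating_face_sum_Cons [simp]:
  "alternating_face_sum c (x # s) = c s - alternating_face_sum (\<lambda>t. c (x # t)) s"
  by (simp add: alternating_face_sum_def sum.lessThan_Suc_shift sum_negf del: sum.lessThan_Suc)

lemma alternating_face_sum_diff:
  "alternating_face_sum (\<lambda>t. c t - d t) s = alternating_face_sum c s - alternating_face_sum d s"
  by (simp add: alternating_face_sum_def algebra_simps sum_subtractf)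

lemma alternating_face_sum_add:
  "alternating_face_sum (\<lambda>t. c t + d t) s = alternating_face_sum c s + alternating_face_sum d s"
  by (simp add: alternating_face_sum_def algebra_simps sum.distrib)

lemma alternating_face_sum_map:
  "alternating_face_sum c (map f s) = alternating_face_sum (\<lambda>t. c (map f t)) s"
  by (simp add: alternating_face_sum_def take_map drop_map)

lemma alternating_face_sum_cong:
  assumes "\<And>i. i < length s \<Longrightarrow> c (take i s @ drop (Suc i) s) = d (take i s @ drop (Suc i) s)"
  shows "alternating_face_sum c s = alternating_face_sum d s"
  using assms by (simp add: alternating_face_sum_def)

text \<open>This is the identity \<open>\<delta>\<delta> = 0\<close>: peeling off the head cancels the
  contributions of the tail in pairs, and the induction hypothesis for the cochain with fixed first
  vertex removes what is left.\<close>

lemma alternating_face_sum_face_sum: "alternating_face_sum (alternating_face_sum c) s = 0"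
proof (induction s arbitrary: c)
  case (Cons x s)
  then show ?case
    by (simp add: alternating_face_sum_diff)
qed simp

text \<open>The prism operator is the signed sum over \<open>i\<close> of the values of \<open>c\<close> on
  \<open>(f x\<^sub>0, \<dots>, f x\<^sub>i, g x\<^sub>i, \<dots>, g x\<^sub>p)\<close>, written as a recursion that
  matches the one for \<^const>\<open>alternating_face_sum\<close>.\<close>

fun prism :: "('a \<Rightarrow> 'b) \<Rightarrow> ('a \<Rightarrow> 'b) \<Rightarrow> ('b list \<Rightarrow> int) \<Rightarrow> 'a list \<Rightarrow> int"
  where
    "prism f g c [] = 0"
  | "prism f g c (x # s) = c (f x # g x # map g s) - prism f g (\<lambda>t. c (f x # t)) s"

lemma prism_diff: "prism f g (\<lambda>t. c t - d t) s = prism f g c s - prism f g d s"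
  by (induction s arbitrary: c d) simp_all

text \<open>Any two vertex maps induce chain homotopic maps on all of the lists; the geometry only enters
  when the lists have to be simplices.\<close>

lemma prism_homotopy:
  "alternating_face_sum (prism f g c) s + prism f g (alternating_face_sum c) s
     = c (map g s) - c (map f s)"
proof (induction s arbitrary: c)
  case (Cons x s)
  show ?case
    using Cons.IH[of "\<lambda>t. c (f x # t)"]
    by (simp add: alternating_face_sum_diff prism_diff alternating_face_sum_map)
qed simp

lemma prism_eq_0:
  assumes "\<And>i. i < length s \<Longrightarrow> c (map f (take (Suc i) s) @ map g (drop i s)) = 0"
  shows "prism f g c s = 0"
  using assms
proof (induction s arbitrary: c)
  case (Cons x s)
  have "prism f g (\<lambda>t. c (f x # t)) s = 0"
    using Cons.prems[of "Suc i" for i] by (intro Cons.IH) simp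
  then show ?case
    using Cons.prems[of 0] by simp
qed simp

text \<open>A constant cochain has coboundary zero or itself according to parity, which is why a one-point
  complex with repeated vertices has no cohomology in positive degrees.\<close>

lemma alternating_face_sum_const_replicate:
  "alternating_face_sum (\<lambda>_. z) (s :: 'a list) = (if odd (length s) then z else 0)"
  by (induction s) auto

section \<open>Cocycles, coboundaries and the direct limit\<close>

lemma nerve_simplices_face:
  assumes "s \<in> nerve_simplices \<U> (Suc p)" "i < length s"
  shows "take i s @ drop (Suc i) s \<in> nerve_simplices \<U> p"
proof -
  have "set (take i s @ drop (Suc i) s) \<subseteq> set s"
    using set_take_subset set_drop_subset by fastforce
  then have "\<Inter>(set s) \<subseteq> \<Inter>(set (take i s @ drop (Suc i) s))" "set s \<subseteq> \<U> \<Longrightarrow> set (take i s @ drop (Suc i) s) \<subseteq> \<U>"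
    by (rule Inter_anti_mono, blast)
  then show ?thesis
    using assms unfolding nerve_simplices_def by (auto simp del: set_append Inter_iff)
qed

lemma nerve_simplices_map:
  assumes "refinement_map \<V> \<U> \<pi>" "s \<in> nerve_simplices \<V> p"
  shows "map \<pi> s \<in> nerve_simplices \<U> p"
  using assms unfolding nerve_simplices_def refinement_map_def by fastforce

lemma cech_coboundary_eq:
  "cech_coboundary \<U> p c = restrict (alternating_face_sum c) (nerve_simplices \<U> (Suc p))"
  unfolding cech_coboundary_def alternating_face_sum_def
  by (rule restrict_ext) (auto simp: nerve_simplices_def lessThan_Suc_atMost)

lemma cech_coboundary_restrict:
  "cech_coboundary \<U> p (restrict c (nerve_simplices \<U> p)) = cech_coboundary \<U> p c"
  unfolding cech_coboundary_eq
  by (intro restrict_ext alternating_face_sum_cong) (simp add: nerve_simplices_face)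

lemma carrier_cech_cochain_group:
  "carrier (cech_cochain_group \<U> p) = extensional (nerve_simplices \<U> p)"
  by (auto simp: cech_cochain_group_def PiE_def integer_group_def)

lemma comm_group_cech_cochain_group: "comm_group (cech_cochain_group \<U> p)"
proof (rule group.group_comm_groupI)
  show "group (cech_cochain_group \<U> p)"
    by (simp add: cech_cochain_group_def)
qed (auto simp: cech_cochain_group_def integer_group_def intro!: restrict_ext)

lemma group_hom_cech_coboundary:
  "group_hom (cech_cochain_group \<U> p) (cech_cochain_group \<U> (Suc p)) (cech_coboundary \<U> p)"
proof -
  have "cech_coboundary \<U> p (restrict (\<lambda>s. c s + d s) (nerve_simplices \<U> p)) =
    (\<lambda>s\<in>nerve_simplices \<U> (Suc p). cech_coboundary \<U> p c s + cech_coboundary \<U> p d s)" for c d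
    unfolding cech_coboundary_restrict
    unfolding cech_coboundary_eq by (auto simp: alternating_face_sum_add intro!: restrict_ext)
  then have "cech_coboundary \<U> p \<in> hom (cech_cochain_group \<U> p) (cech_cochain_group \<U> (Suc p))"
    by (auto simp: hom_def carrier_cech_cochain_group cech_coboundary_eq)
       (simp add: cech_cochain_group_def integer_group_def)
  then show ?thesis
    by (simp add: group_hom_def group_hom_axioms_def comm_group_cech_cochain_group comm_group.axioms(2))
qed

lemma cech_cocycles_iff:
  "c \<in> cech_cocycles \<U> p \<longleftrightarrow> c \<in> extensional (nerve_simplices \<U> p) \<and>
     (\<forall>s\<in>nerve_simplices \<U> (Suc p). alternating_face_sum c s = 0)"
  unfolding cech_cocycles_def kernel_def carrier_cech_cochain_group
  by (auto simp: cech_coboundary_eq cech_cochain_group_def restrict_def fun_eq_iff)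

lemma subgroup_cech_cocycles: "subgroup (cech_cocycles \<U> p) (cech_cochain_group \<U> p)"
  unfolding cech_cocycles_def
  by (rule group_hom.subgroup_kernel[OF group_hom_cech_coboundary])

lemma subgroup_cech_coboundaries: "subgroup (cech_coboundaries \<U> p) (cech_cochain_group \<U> p)"
proof (cases p)
  case 0
  then show ?thesis
    by (simp add: cech_coboundaries_def group.triv_subgroup comm_group_cech_cochain_group comm_group.axioms(2))
next
  case (Suc q)
  then show ?thesis
    using group_hom.img_is_subgroup[OF group_hom_cech_coboundary[of \<U> q]]
    by (simp add: cech_coboundaries_def)
qed

lemma cech_coboundaries_subset_cocycles: "cech_coboundaries \<U> p \<subseteq> cech_cocycles \<U> p"
proof (cases p)
  case 0
  then show ?thesis
    using subgroup.one_closed[OF subgroup_cech_cocycles[of \<U> 0]] by (simp add: cech_coboundaries_def)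
next
  case (Suc q)
  have "cech_coboundary \<U> q c \<in> cech_cocycles \<U> (Suc q)" for c
  proof -
    have "alternating_face_sum (cech_coboundary \<U> q c) s = alternating_face_sum (alternating_face_sum c) s"
      if "s \<in> nerve_simplices \<U> (Suc (Suc q))" for s
      unfolding cech_coboundary_eq
      using that by (intro alternating_face_sum_cong) (simp add: nerve_simplices_face)
    then show ?thesis
      by (simp add: cech_cocycles_iff alternating_face_sum_face_sum)  (simp add: cech_coboundary_eq)
  qed
  then show ?thesis
    by (auto simp: cech_coboundaries_def Suc)
qed

lemma cech_pullback_cocycle:
  assumes "refinement_map \<V> \<U> \<pi>" "c \<in> cech_cocycles \<U> p"
  shows "cech_pullback p \<V> \<pi> c \<in> cech_cocycles \<V> p"
proof -
  have "alternating_face_sum (cech_pullback p \<V> \<pi> c) s = 0" if s: "s \<in> nerve_simplices \<V> (Suc p)" for s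
  proof -
    have "alternating_face_sum (cech_pullback p \<V> \<pi> c) s = alternating_face_sum (\<lambda>t. c (map \<pi> t)) s"
      using s unfolding cech_pullback_def
      by (intro alternating_face_sum_cong) (simp add: nerve_simplices_face)
    then show ?thesis
      using assms(2) nerve_simplices_map[OF assms(1) s]
      by (simp add: alternating_face_sum_map[symmetric] cech_cocycles_iff)
  qed
  then show ?thesis
    by (simp add: cech_cocycles_iff) (simp add: cech_pullback_def)
qed

text \<open>Values of the primitive \<open>b\<close> off the nerve are harmless, since faces of simplices are
  simplices.\<close>

lemma cech_coboundariesI:
  assumes "c \<in> extensional (nerve_simplices \<U> (Suc q))"
    and "\<And>s. s \<in> nerve_simplices \<U> (Suc q) \<Longrightarrow> c s = alternating_face_sum b s"
  shows "c \<in> cech_coboundaries \<U> (Suc q)"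
proof -
  have "c = cech_coboundary \<U> q b"
    using assms by (auto simp: cech_coboundary_eq restrict_def extensional_def fun_eq_iff)
  also have "\<dots> = cech_coboundary \<U> q (restrict b (nerve_simplices \<U> q))"
    by (simp add: cech_coboundary_restrict)
  finally show ?thesis
    by (simp add: cech_coboundaries_def carrier_cech_cochain_group)
qed

lemma comm_group_cocycle_group:
  "comm_group (subgroup_generated (cech_cochain_group \<U> p) (cech_cocycles \<U> p))"
  by (simp add: comm_group_cech_cochain_group comm_group.axioms(2) group.abelian_subgroup_generated)

lemma carrier_cocycle_group:
  "carrier (subgroup_generated (cech_cochain_group \<U> p) (cech_cocycles \<U> p)) = cech_cocycles \<U> p"
  by (simp add: subgroup.carrier_subgroup_generated_subgroup subgroup_cech_cocycles)

lemma normal_coboundaries_in_cocycle_group: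
  "cech_coboundaries \<U> p \<lhd> subgroup_generated (cech_cochain_group \<U> p) (cech_cocycles \<U> p)"
  by (intro comm_group.subgroup_imp_normal comm_group_cocycle_group)
     (simp add: group.subgroup_subgroup_generated_iff comm_group_cech_cochain_group comm_group.axioms(2)
        subgroup_cech_coboundaries carrier_cocycle_group cech_coboundaries_subset_cocycles)

lemma comm_group_cover_cohomology_group: "comm_group (cover_cohomology_group p \<U>)"
  unfolding cover_cohomology_group_def
  using comm_group.abelian_FactGroup[OF comm_group_cocycle_group]
    normal_coboundaries_in_cocycle_group normal_imp_subgroup by blast

lemma carrier_cover_cohomology_group:
  "carrier (cover_cohomology_group p \<U>) = cover_cohomology_class p \<U> ` cech_cocycles \<U> p"
  unfolding cover_cohomology_group_def carrier_FactGroup carrier_cocycle_group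
  by (simp add: cover_cohomology_class_def[abs_def] r_coset_def)

lemma cover_cohomology_class_coboundary:
  assumes "c \<in> cech_coboundaries \<U> p"
  shows "cover_cohomology_class p \<U> c = \<one>\<^bsub>cover_cohomology_group p \<U>\<^esub>"
  using assms unfolding cover_cohomology_class_def cover_cohomology_group_def
  by (simp add: subgroup.rcos_const subgroup_cech_coboundaries comm_group_cech_cochain_group comm_group.axioms(2))

text \<open>In the direct limit a class equals its pullback along a refinement.  If every cocycle becomes a
  coboundary on some refinement, then the image of each summand lies in the subgroup of relators;
  elements of the direct sum have finite support and are products of such images, so the relators
  generate everything.\<close>

theorem trivial_cech_cohomology_groupI:
  assumes "\<And>\<U> c. \<U> \<in> open_covers X \<Longrightarrow> c \<in> cech_cocycles \<U> p \<Longrightarrow>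
    \<exists>\<V>\<in>open_covers X. \<exists>\<pi>. refinement_map \<V> \<U> \<pi> \<and> cech_pullback p \<V> \<pi> c \<in> cech_coboundaries \<V> p"
  shows "trivial_group (cech_cohomology_group p X)"
proof -
  define G where "G = cover_cohomology_sum p X"
  define H where "H = generate G (refinement_relators p X)"
  let ?C = "cover_cohomology_group p"
  have grp: "group (?C \<U>)" for \<U> :: "'a set set"
    by (simp add: comm_group_cover_cohomology_group comm_group.axioms(2))
  have carG: "carrier G = {x \<in> \<Pi>\<^sub>E \<U>\<in>open_covers X. carrier (?C \<U>). finite {\<U> \<in> open_covers X. x \<U> \<noteq> \<one>\<^bsub>?C \<U>\<^esub>}}"
    unfolding G_def cover_cohomology_sum_def by (rule carrier_sum_group) (rule grp)
  have multG: "x \<otimes>\<^bsub>G\<^esub> y = (\<lambda>\<U>\<in>open_covers X. x \<U> \<otimes>\<^bsub>?C \<U>\<^esub> y \<U>)" for x y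
    by (simp add: G_def cover_cohomology_sum_def)
  have oneG: "\<one>\<^bsub>G\<^esub> = (\<lambda>\<U>\<in>open_covers X. \<one>\<^bsub>?C \<U>\<^esub>)"
    by (simp add: G_def cover_cohomology_sum_def)
  have "group G"
    by (simp add: G_def cover_cohomology_sum_def grp)
  interpret G: comm_group G
  proof (rule group.group_comm_groupI[OF \<open>group G\<close>])
    show "x \<otimes>\<^bsub>G\<^esub> y = y \<otimes>\<^bsub>G\<^esub> x" if "x \<in> carrier G" "y \<in> carrier G" for x y
      using that unfolding multG carG
      by (intro restrict_ext comm_monoid.m_comm[OF comm_group.axioms(1)[OF comm_group_cover_cohomology_group]]) auto
  qed
  have incl_mem: "cover_cohomology_incl p X \<U> h \<in> carrier G"
    if "h \<in> carrier (?C \<U>)" for \<U> h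
  proof -
    have "{\<V> \<in> open_covers X. cover_cohomology_incl p X \<U> h \<V> \<noteq> \<one>\<^bsub>?C \<V>\<^esub>} \<subseteq> {\<U>}"
      by (auto simp: cover_cohomology_incl_def)
    then show ?thesis
      using that unfolding carG
      by (auto simp: cover_cohomology_incl_def group.is_monoid grp intro: finite_subset)
  qed
  have incl_H: "cover_cohomology_incl p X \<U> h \<in> H"
    if \<U>: "\<U> \<in> open_covers X" and h: "h \<in> carrier (?C \<U>)" for \<U> h
  proof -
    obtain c where c: "c \<in> cech_cocycles \<U> p" "h = cover_cohomology_class p \<U> c"
      using h unfolding carrier_cover_cohomology_group by blast
    obtain \<V> \<pi> where \<V>: "\<V> \<in> open_covers X" "refinement_map \<V> \<U> \<pi>"
      "cech_pullback p \<V> \<pi> c \<in> cech_coboundaries \<V> p"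
      using assms[OF \<U> c(1)] by blast
    \<comment> \<open>The relator of \<open>\<U>\<close>, \<open>\<V>\<close>, \<open>\<pi>\<close> and \<open>c\<close> has a trivial second factor, so it is the image of \<open>h\<close>.\<close>
    let ?i = "cover_cohomology_incl p X"
    have "?i \<V> (cover_cohomology_class p \<V> (cech_pullback p \<V> \<pi> c)) = \<one>\<^bsub>G\<^esub>"
      unfolding cover_cohomology_class_coboundary[OF \<V>(3)] cover_cohomology_incl_def oneG
      by (rule restrict_ext) (simp split: if_split)
    then have eq: "?i \<U> h \<otimes>\<^bsub>G\<^esub> inv\<^bsub>G\<^esub> \<one>\<^bsub>G\<^esub> =
        ?i \<U> (cover_cohomology_class p \<U> c) \<otimes>\<^bsub>G\<^esub>
        inv\<^bsub>G\<^esub> ?i \<V> (cover_cohomology_class p \<V> (cech_pullback p \<V> \<pi> c))"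
      unfolding c(2) by simp
    have "?i \<U> h \<otimes>\<^bsub>G\<^esub> inv\<^bsub>G\<^esub> \<one>\<^bsub>G\<^esub> \<in> refinement_relators p X"
      unfolding refinement_relators_def G_def[symmetric]
      by (rule CollectI, intro exI conjI) (rule eq, fact \<U>, fact \<V>(1), fact \<V>(2), fact c(1))
    then show ?thesis
      unfolding H_def using incl_mem[OF h] by (simp add: generate.incl)
  qed
  have rel: "refinement_relators p X \<subseteq> carrier G"
  proof -
    have "cech_pullback p \<V> \<pi> c \<in> cech_cocycles \<V> p"
      if "refinement_map \<V> \<U> \<pi>" "c \<in> cech_cocycles \<U> p" for \<U> \<V> :: "'a set set" and \<pi> c
      using that by (rule cech_pullback_cocycle)
    then show ?thesis
      unfolding refinement_relators_def G_def[symmetric]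
      by (auto intro!: G.m_closed G.inv_closed incl_mem simp: carrier_cover_cohomology_group)
  qed
  have subH: "subgroup H G"
    unfolding H_def by (rule G.generate_is_subgroup[OF rel])
  have supported: "x \<in> H" if "finite F" "x \<in> carrier G" "{\<U> \<in> open_covers X. x \<U> \<noteq> \<one>\<^bsub>?C \<U>\<^esub>} \<subseteq> F" for F x
    using that
  proof (induction F arbitrary: x rule: finite_induct)
    case empty
    then have "x = \<one>\<^bsub>G\<^esub>"
      unfolding oneG carG by (auto simp: PiE_def extensional_def fun_eq_iff)
    then show ?case
      using subH subgroup.one_closed by blast
  next
    case (insert \<U> F)
    show ?case
    proof (cases "\<U> \<in> open_covers X")
      case False
      then show ?thesis
        using insert by auto
    next
      case True
      define y where "y = x(\<U> := \<one>\<^bsub>?C \<U>\<^esub>)"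
      have x: "x \<in> (\<Pi>\<^sub>E \<V>\<in>open_covers X. carrier (?C \<V>))"
        and fin: "finite {\<V> \<in> open_covers X. x \<V> \<noteq> \<one>\<^bsub>?C \<V>\<^esub>}"
        using insert.prems(1) unfolding carG by blast+
      have xU: "x \<U> \<in> carrier (?C \<U>)"
        using x True by (rule PiE_mem)
      have "y \<in> (\<Pi>\<^sub>E \<V>\<in>insert \<U> (open_covers X). carrier (?C \<V>))"
        unfolding y_def by (intro PiE_fun_upd x monoid.one_closed group.is_monoid grp)
      moreover have "finite {\<V> \<in> open_covers X. y \<V> \<noteq> \<one>\<^bsub>?C \<V>\<^esub>}"
        by (rule finite_subset[OF _ fin]) (simp add: y_def subset_iff)
      ultimately have y: "y \<in> carrier G"
        unfolding carG insert_absorb[OF True] by blast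
      have "y \<in> H"
        using insert.prems(2) by (intro insert.IH y) (auto simp: y_def)
      then have "y \<otimes>\<^bsub>G\<^esub> cover_cohomology_incl p X \<U> (x \<U>) \<in> H"
        using incl_H[OF True xU] by (rule subgroup.m_closed[OF subH])
      moreover have "x = y \<otimes>\<^bsub>G\<^esub> cover_cohomology_incl p X \<U> (x \<U>)"
      proof
        fix \<V>
        show "x \<V> = (y \<otimes>\<^bsub>G\<^esub> cover_cohomology_incl p X \<U> (x \<U>)) \<V>"
        proof (cases "\<V> \<in> open_covers X")
          case True
          then have "x \<V> \<in> carrier (?C \<V>)"
            using x by (rule PiE_mem[rotated])
          then show ?thesis
            using True xU by (simp add: multG y_def cover_cohomology_incl_def group.is_monoid[OF grp])
        next
          case False
          then show ?thesis
            using PiE_arb[OF x] by (simp add: multG)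
        qed
      qed
      ultimately show ?thesis
        by (rule back_subst[of "\<lambda>z. z \<in> H", OF _ sym])
    qed
  qed
  have "carrier G \<subseteq> H"
  proof
    fix x assume x: "x \<in> carrier G"
    then have "finite {\<U> \<in> open_covers X. x \<U> \<noteq> \<one>\<^bsub>?C \<U>\<^esub>}"
      unfolding carG by blast
    then show "x \<in> H"
      using x order_refl by (rule supported)
  qed
  then have "H #>\<^bsub>G\<^esub> x = H" if "x \<in> carrier G" for x
    using that by (intro G.coset_join2 subH) auto
  then have "carrier (G Mod H) \<subseteq> {\<one>\<^bsub>G Mod H\<^esub>}"
    unfolding carrier_FactGroup one_FactGroup by blast
  moreover have "group (G Mod H)"
    by (rule normal.factorgroup_is_group[OF G.subgroup_imp_normal[OF subH]])
  ultimately have "trivial_group (G Mod H)"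
    by (simp add: group.trivial_group_subset)
  then show ?thesis
    unfolding cech_cohomology_group_def G_def H_def .
qed

section \<open>Compact contractible spaces\<close>

text \<open>Two vertex maps are contiguous if the images of every simplex under both maps together form a
  simplex.  Then the lists in the prism operator are simplices, on which the coboundary of a cocycle
  vanishes, and the prism formula says that the two pullbacks are cohomologous.\<close>

lemma cocycle_contiguous:
  assumes c: "c \<in> cech_cocycles \<U> p"
    and contig: "\<And>S. S \<subseteq> \<V> \<Longrightarrow> \<Inter>S \<noteq> {} \<Longrightarrow> \<exists>x. \<forall>V\<in>S. f V \<in> \<U> \<and> g V \<in> \<U> \<and> x \<in> f V \<and> x \<in> g V"
    and s: "s \<in> nerve_simplices \<V> p"
  shows "c (map g s) - c (map f s) = alternating_face_sum (prism f g c) s"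
proof -
  have "prism f g (alternating_face_sum c) s = 0"
  proof (rule prism_eq_0)
    fix i assume i: "i < length s"
    let ?t = "map f (take (Suc i) s) @ map g (drop i s)"
    obtain x where x: "\<forall>V\<in>set s. f V \<in> \<U> \<and> g V \<in> \<U> \<and> x \<in> f V \<and> x \<in> g V"
      using contig[of "set s"] s unfolding nerve_simplices_def by blast
    have "W \<in> \<U> \<and> x \<in> W" if "W \<in> set ?t" for W
      using that x by (auto dest: in_set_takeD in_set_dropD)
    moreover have "length ?t = Suc (Suc p)"
      using i s by (simp add: nerve_simplices_def)
    ultimately have "?t \<in> nerve_simplices \<U> (Suc p)"
      unfolding nerve_simplices_def by blast
    then show "alternating_face_sum c ?t = 0"
      using c by (simp add: cech_cocycles_iff)
  qed
  then show ?thesis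
    using prism_homotopy[of f g c s] by simp
qed

text \<open>A constant vertex map factors through the complex of a single vertex, so it pulls a cocycle back
  to a coboundary.  For odd \<open>p\<close> the value \<open>c (U, \<dots>, U)\<close> is zero because \<open>c\<close> is a cocycle;
  for even \<open>p\<close> the constant cochain is its own primitive.\<close>

lemma cocycle_constant_map:
  assumes c: "c \<in> cech_cocycles \<U> p" and U: "U \<in> \<U>" "U \<noteq> {}"
    and s: "length s = Suc p"
  shows "c (map (\<lambda>_. U) s) = alternating_face_sum (\<lambda>_. c (replicate (Suc p) U)) s"
proof -
  let ?z = "c (replicate (Suc p) U)"
  let ?t = "replicate (Suc (Suc p)) U"
  have "take i ?t @ drop (Suc i) ?t = replicate (Suc p) U" if "i < length ?t" for i
    using that by (simp add: replicate_add[symmetric] min_def del: replicate_Suc)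
  then have "alternating_face_sum c ?t = alternating_face_sum (\<lambda>_. ?z) ?t"
    by (intro alternating_face_sum_cong arg_cong[where f = c])
  moreover have "?t \<in> nerve_simplices \<U> (Suc p)"
    using U by (auto simp: nerve_simplices_def)
  then have "alternating_face_sum c ?t = 0"
    using c unfolding cech_cocycles_iff by blast
  ultimately have "alternating_face_sum (\<lambda>_. ?z) ?t = 0"
    by (simp only:)
  then have "even p \<or> ?z = 0"
    unfolding alternating_face_sum_const_replicate by (simp split: if_splits)
  then show ?thesis
    unfolding alternating_face_sum_const_replicate map_replicate_const s by auto
qed

text \<open>A Lebesgue number argument in the tube: compactness of the interval gives, near each point, one
  time step that works for a neighbourhood of the point, and compactness of the space makes the time
  step uniform.\<close>

lemma homotopy_uniform_subdivision:
  fixes h :: "real \<times> 'a \<Rightarrow> 'b"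
  assumes X: "compact_space X"
    and h: "continuous_map (prod_topology (top_of_set {0..1}) X) Y h"
    and \<U>: "\<U> \<in> open_covers Y"
  obtains \<epsilon> where "\<epsilon> > 0"
    "\<And>x. x \<in> topspace X \<Longrightarrow> \<exists>V. openin X V \<and> x \<in> V \<and>
       (\<forall>t\<in>{0..1}. \<exists>U\<in>\<U>. \<forall>s\<in>{0..1}. \<forall>y\<in>V. \<bar>s - t\<bar> \<le> \<epsilon> \<longrightarrow> h (s, y) \<in> U)"
proof -
  define good where "good V e \<longleftrightarrow>
    (\<forall>t\<in>{0..1}. \<exists>U\<in>\<U>. \<forall>s\<in>{0..1}. \<forall>y\<in>V. \<bar>s - t\<bar> \<le> e \<longrightarrow> h (s, y) \<in> U)" for V e
  have good_antimono: "good V d" if "good V e" "d \<le> e" for V d e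
    using that unfolding good_def by (meson order_trans)
  have local: "\<exists>V e. openin X V \<and> x \<in> V \<and> e > 0 \<and> good V e" if x: "x \<in> topspace X" for x
  proof -
    have "\<exists>V r. openin X V \<and> x \<in> V \<and> r > 0 \<and> (\<exists>U\<in>\<U>. \<forall>s\<in>{0..1}. \<forall>y\<in>V. \<bar>s - t\<bar> < 2 * r \<longrightarrow> h (s, y) \<in> U)"
      if t: "t \<in> {0..1}" for t
    proof -
      have "h (t, x) \<in> topspace Y"
        using continuous_map_image_subset_topspace[OF h] x t by fastforce
      then obtain U where U: "U \<in> \<U>" "h (t, x) \<in> U" "openin Y U"
        using \<U> unfolding open_covers_def by blast
      let ?W = "{z \<in> topspace (prod_topology (top_of_set {0..1}) X). h z \<in> U}"
      have "openin (prod_topology (top_of_set {0..1}) X) ?W"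
        using h U(3) by (rule openin_continuous_map_preimage)
      moreover have "(t, x) \<in> ?W"
        using x t U by simp
      ultimately obtain J V where J: "openin (top_of_set {0..1}) J" "t \<in> J"
        and V: "openin X V" "x \<in> V" and JV: "J \<times> V \<subseteq> ?W"
        unfolding openin_prod_topology_alt by meson
      obtain e where e: "e > 0" "ball t e \<inter> {0..1} \<subseteq> J"
        using J unfolding openin_contains_ball by blast
      have "h (s, y) \<in> U" if "s \<in> {0..1}" "y \<in> V" "\<bar>s - t\<bar> < 2 * (e / 2)" for s y
      proof -
        have "s \<in> J"
          using e(2) that by (auto simp: dist_real_def abs_minus_commute)
        then show ?thesis
          using JV that(2) by blast
      qed
      then show ?thesis
        using V U(1) e(1) by (intro exI[of _ V] exI[of _ "e / 2"] conjI bexI[of _ U] ballI impI) auto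
    qed
    then obtain V r where Vr: "\<And>t. t \<in> {0..1} \<Longrightarrow> openin X (V t) \<and> x \<in> V t \<and> r t > 0 \<and>
        (\<exists>U\<in>\<U>. \<forall>s\<in>{0..1}. \<forall>y\<in>V t. \<bar>s - t\<bar> < 2 * r t \<longrightarrow> h (s, y) \<in> U)"
      by metis
    have "{0..1} \<subseteq> (\<Union>t\<in>{0..1::real}. ball t (r t))"
      using Vr by fastforce
    then obtain D where D: "D \<subseteq> {0..1}" "finite D" "{0..1} \<subseteq> (\<Union>t\<in>D. ball t (r t))"
      using compactE_image[OF compact_Icc, of "{0..1}" "\<lambda>t. ball t (r t)" 0 1] by auto
    then have "D \<noteq> {}"
      by force
    define e where "e = Min (r ` D)"
    have e: "e > 0" "\<And>t. t \<in> D \<Longrightarrow> e \<le> r t"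
      using D Vr \<open>D \<noteq> {}\<close> by (auto simp: e_def)
    \<comment> \<open>The slack factor 2 in the choice of \<open>r\<close> leaves room for the window of radius \<open>e\<close> around each \<open>t\<close>.\<close>
    have "good (\<Inter>t\<in>D. V t) e"
      unfolding good_def
    proof
      fix t :: real assume "t \<in> {0..1}"
      then obtain d where d: "d \<in> D" "\<bar>t - d\<bar> < r d"
        using D(3) by (auto simp: dist_real_def abs_minus_commute)
      then obtain U where U: "U \<in> \<U>" "\<forall>s\<in>{0..1}. \<forall>y\<in>V d. \<bar>s - d\<bar> < 2 * r d \<longrightarrow> h (s, y) \<in> U"
        using Vr D(1) by blast
      have "\<bar>s - d\<bar> < 2 * r d" if "\<bar>s - t\<bar> \<le> e" for s
        using e(2)[OF d(1)] d(2) that by linarith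
      then show "\<exists>U\<in>\<U>. \<forall>s\<in>{0..1}. \<forall>y\<in>\<Inter>t\<in>D. V t. \<bar>s - t\<bar> \<le> e \<longrightarrow> h (s, y) \<in> U"
        using U d(1) by (intro bexI[of _ U]) auto
    qed
    moreover have "openin X (\<Inter>t\<in>D. V t)"
      using D Vr \<open>D \<noteq> {}\<close> by (intro openin_INT2) auto
    moreover have "x \<in> (\<Inter>t\<in>D. V t)"
      using D Vr by auto
    ultimately show ?thesis
      using e(1) by blast
  qed
  then obtain V e where Ve: "\<And>x. x \<in> topspace X \<Longrightarrow> openin X (V x) \<and> x \<in> V x \<and> e x > 0 \<and> good (V x) (e x)"
    by metis
  have "topspace X \<subseteq> \<Union>(V ` topspace X)" "\<forall>W\<in>V ` topspace X. openin X W"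
    using Ve by auto
  then obtain \<F> where "finite \<F>" "\<F> \<subseteq> V ` topspace X" "topspace X \<subseteq> \<Union>\<F>"
    using X unfolding compact_space_alt by (metis (no_types, lifting))
  then obtain F where F: "finite F" "F \<subseteq> topspace X" "topspace X \<subseteq> \<Union>(V ` F)"
    by (metis finite_subset_image)
  define \<epsilon> where "\<epsilon> = Min (insert 1 (e ` F))"
  have \<epsilon>: "\<epsilon> > 0" "\<And>x. x \<in> F \<Longrightarrow> \<epsilon> \<le> e x"
    using F Ve by (auto simp: \<epsilon>_def)
  show ?thesis
  proof (rule that[OF \<epsilon>(1)])
    fix x assume "x \<in> topspace X"
    then obtain z where z: "z \<in> F" "x \<in> V z"
      using F(3) by blast
    then have "good (V z) \<epsilon>"
      using Ve \<epsilon>(2) F(2) good_antimono by blast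
    then show "\<exists>V. openin X V \<and> x \<in> V \<and>
       (\<forall>t\<in>{0..1}. \<exists>U\<in>\<U>. \<forall>s\<in>{0..1}. \<forall>y\<in>V. \<bar>s - t\<bar> \<le> \<epsilon> \<longrightarrow> h (s, y) \<in> U)"
      using z Ve F(2) unfolding good_def by (intro exI[of _ "V z"] conjI) auto
  qed
qed

text \<open>Homotopy invariance in the case that is needed.  Cut the contraction \<open>h\<close> into time steps so
  short that a common refinement \<open>\<V>\<close> of the cover has the following property: during the
  \<open>k\<close>-th step each \<open>V\<close> in \<open>\<V>\<close> stays inside a member \<open>F k V\<close> of the cover.  Then \<open>F 0\<close> is a
  refinement map, since \<open>h\<close> starts at the identity.  The maps \<open>F k\<close> and \<open>F (k + 1)\<close> are
  contiguous, because at the common time of the two steps the image of \<open>\<Inter>S\<close> lies in all the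
  chosen sets.  The last map is contiguous to a constant map, because \<open>h\<close> ends at a point.  So the
  pullback of a cocycle along \<open>F 0\<close> is a coboundary.\<close>

theorem trivial_cech_cohomology_compact_contractible:
  assumes X: "compact_space X" "contractible_space X" and p: "p \<ge> 1"
  shows "trivial_group (cech_cohomology_group p X)"
proof (rule trivial_cech_cohomology_groupI)
  fix \<U> :: "'a set set" and c
  assume \<U>: "\<U> \<in> open_covers X" and c: "c \<in> cech_cocycles \<U> p"
  obtain q where q: "p = Suc q"
    using p by (cases p) auto
  obtain a h where h: "continuous_map (prod_topology (top_of_set {0..1::real}) X) X h"
    and h0: "\<And>x. h (0, x) = x" and h1: "\<And>x. h (1, x) = a"
    using X(2) unfolding contractible_space_def homotopic_with_def by auto
  have hX: "h (t, x) \<in> topspace X" if "t \<in> {0..1}" "x \<in> topspace X" for t x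
    using continuous_map_image_subset_topspace[OF h] that by fastforce
  obtain \<epsilon> where \<epsilon>: "\<epsilon> > 0"
    "\<And>x. x \<in> topspace X \<Longrightarrow> \<exists>V. openin X V \<and> x \<in> V \<and>
       (\<forall>t\<in>{0..1}. \<exists>U\<in>\<U>. \<forall>s\<in>{0..1}. \<forall>y\<in>V. \<bar>s - t\<bar> \<le> \<epsilon> \<longrightarrow> h (s, y) \<in> U)"
    using homotopy_uniform_subdivision[OF X(1) h \<U>] by blast
  define \<V> where "\<V> = {V. openin X V \<and>
    (\<forall>t\<in>{0..1}. \<exists>U\<in>\<U>. \<forall>s\<in>{0..1}. \<forall>y\<in>V. \<bar>s - t\<bar> \<le> \<epsilon> \<longrightarrow> h (s, y) \<in> U)}"
  have \<V>: "\<V> \<in> open_covers X"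
    unfolding open_covers_def
  proof (intro CollectI conjI ballI equalityI subsetI)
    fix x assume "x \<in> topspace X"
    from \<epsilon>(2)[OF this] obtain V where "V \<in> \<V>" "x \<in> V"
      unfolding \<V>_def by auto
    then show "x \<in> \<Union>\<V>"
      by blast
  qed (auto simp: \<V>_def dest: openin_subset)
  obtain N :: nat where N: "1 / real (Suc N) < \<epsilon>"
    using \<epsilon>(1) nat_approx_posE by blast
  have F_ex: "\<exists>U\<in>\<U>. \<forall>s. real k / Suc N \<le> s \<and> s \<le> real (Suc k) / Suc N \<longrightarrow> (\<forall>y\<in>V. h (s, y) \<in> U)"
    if "V \<in> \<V>" "k \<le> N" for V k
  proof -
    let ?t = "real k / Suc N"
    have "?t \<in> {0..1}"
      using that(2) by (auto simp: field_simps)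
    moreover have "\<forall>t\<in>{0..1}. \<exists>U\<in>\<U>. \<forall>s\<in>{0..1}. \<forall>y\<in>V. \<bar>s - t\<bar> \<le> \<epsilon> \<longrightarrow> h (s, y) \<in> U"
      using that(1) unfolding \<V>_def by blast
    ultimately have "\<exists>U\<in>\<U>. \<forall>s\<in>{0..1}. \<forall>y\<in>V. \<bar>s - ?t\<bar> \<le> \<epsilon> \<longrightarrow> h (s, y) \<in> U"
      by (rule bspec[rotated])
    then obtain U where U: "U \<in> \<U>" "\<forall>s\<in>{0..1}. \<forall>y\<in>V. \<bar>s - ?t\<bar> \<le> \<epsilon> \<longrightarrow> h (s, y) \<in> U" ..
    have "s \<in> {0..1} \<and> \<bar>s - ?t\<bar> \<le> \<epsilon>" if s: "?t \<le> s" "s \<le> real (Suc k) / Suc N" for s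
    proof -
      have "real (Suc k) / Suc N = ?t + 1 / Suc N"
        by (simp add: add_divide_distrib)
      moreover have "real (Suc k) / Suc N \<le> 1"
        using \<open>k \<le> N\<close> by simp
      moreover have "0 \<le> ?t"
        by simp
      ultimately show ?thesis
        using s N by (simp only: atLeastAtMost_iff abs_le_iff) linarith
    qed
    then show ?thesis
      using U by blast
  qed
  define F where "F k V = (SOME U. U \<in> \<U> \<and> (\<forall>s. real k / Suc N \<le> s \<and> s \<le> real (Suc k) / Suc N
      \<longrightarrow> (\<forall>y\<in>V. h (s, y) \<in> U)))" for k V
  have F: "F k V \<in> \<U>"
    "real k / Suc N \<le> s \<Longrightarrow> s \<le> real (Suc k) / Suc N \<Longrightarrow> y \<in> V \<Longrightarrow> h (s, y) \<in> F k V"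
    if "V \<in> \<V>" "k \<le> N" for V k s y
    using someI_ex[OF F_ex[OF that, unfolded Bex_def], folded F_def] by blast+
  have ref: "refinement_map \<V> \<U> (F 0)"
    using F(1)[of _ 0] F(2)[of _ 0 0] by (auto simp: refinement_map_def h0)
  have steps: "\<exists>b. \<forall>s\<in>nerve_simplices \<V> p. c (map (F k) s) - c (map (F 0) s) = alternating_face_sum b s"
    if "k \<le> N" for k
    using that
  proof (induction k)
    case 0
    then show ?case
      by (intro exI[of _ "\<lambda>_. 0"]) (simp add: alternating_face_sum_def)
  next
    case (Suc k)
    then obtain b where b: "\<forall>s\<in>nerve_simplices \<V> p. c (map (F k) s) - c (map (F 0) s) = alternating_face_sum b s"
      by auto
    have contig: "\<exists>x. \<forall>V\<in>S. F k V \<in> \<U> \<and> F (Suc k) V \<in> \<U> \<and> x \<in> F k V \<and> x \<in> F (Suc k) V"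
      if S: "S \<subseteq> \<V>" "\<Inter>S \<noteq> {}" for S
    proof -
      obtain y where "y \<in> \<Inter>S"
        using S(2) by blast
      then have "h (real (Suc k) / Suc N, y) \<in> F k V \<and> h (real (Suc k) / Suc N, y) \<in> F (Suc k) V"
        if "V \<in> S" for V
        using S(1) that Suc.prems by (intro conjI F(2)) (auto simp: divide_right_mono)
      then show ?thesis
        using F(1) S(1) Suc.prems by (meson Suc_leD subsetD)
    qed
    have step: "c (map (F (Suc k)) s) - c (map (F k) s) = alternating_face_sum (prism (F k) (F (Suc k)) c) s"
      if "s \<in> nerve_simplices \<V> p" for s
      using c contig that by (rule cocycle_contiguous)
    have "c (map (F (Suc k)) s) - c (map (F 0) s) =
        alternating_face_sum (\<lambda>s. b s + prism (F k) (F (Suc k)) c s) s"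
      if "s \<in> nerve_simplices \<V> p" for s
      using step[OF that] bspec[OF b that] by (simp add: alternating_face_sum_add)
    then show ?case
      by (intro exI ballI)
  qed
  have "\<exists>b. \<forall>s\<in>nerve_simplices \<V> p. c (map (F 0) s) = alternating_face_sum b s"
  \<comment> \<open>A \<open>p\<close>-simplex provides a point of \<open>X\<close>; on the empty space the end point \<open>a\<close> is not a point of \<open>X\<close>.\<close>
  proof (cases "nerve_simplices \<V> p = {}")
    case False
    then obtain V x where "V \<in> \<V>" "x \<in> V"
      unfolding nerve_simplices_def by (auto simp: length_Suc_conv)
    then have "a \<in> topspace X"
      using hX[of 1 x] h1 \<V> by (auto simp: open_covers_def)
    then obtain U where U: "U \<in> \<U>" "a \<in> U"
      using \<U> unfolding open_covers_def by blast
    obtain b where b: "\<forall>s\<in>nerve_simplices \<V> p. c (map (F N) s) - c (map (F 0) s) = alternating_face_sum b s"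
      using steps by blast
    have contig: "\<exists>x. \<forall>V\<in>S. F N V \<in> \<U> \<and> U \<in> \<U> \<and> x \<in> F N V \<and> x \<in> U"
      if S: "S \<subseteq> \<V>" "\<Inter>S \<noteq> {}" for S
    proof -
      obtain y where y: "y \<in> \<Inter>S"
        using S(2) by blast
      have "a \<in> F N V" if "V \<in> S" for V
      proof -
        have "h (1, y) \<in> F N V"
          using S(1) that y by (intro F(2)) auto
        then show ?thesis
          by (simp add: h1)
      qed
      then show ?thesis
        using F(1) S(1) U by blast
    qed
    have F_const: "c (map (\<lambda>_. U) s) - c (map (F N) s) = alternating_face_sum (prism (F N) (\<lambda>_. U) c) s"
      if "s \<in> nerve_simplices \<V> p" for s
      using c contig that by (rule cocycle_contiguous)
    have const: "c (map (\<lambda>_. U) s) = alternating_face_sum (\<lambda>_. c (replicate (Suc p) U)) s"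
      if "s \<in> nerve_simplices \<V> p" for s
      using that U by (intro cocycle_constant_map[OF c]) (auto simp: nerve_simplices_def)
    have "c (map (F 0) s) = alternating_face_sum
        (\<lambda>t. c (replicate (Suc p) U) - (b t + prism (F N) (\<lambda>_. U) c t)) s"
      if s: "s \<in> nerve_simplices \<V> p" for s
      using F_const[OF s] const[OF s] bspec[OF b s]
      by (simp add: alternating_face_sum_diff alternating_face_sum_add)
    then show ?thesis
      by (intro exI) blast
  qed simp
  then obtain b where "\<And>s. s \<in> nerve_simplices \<V> p \<Longrightarrow> c (map (F 0) s) = alternating_face_sum b s"
    by blast
  then have "cech_pullback p \<V> (F 0) c \<in> cech_coboundaries \<V> p"
    unfolding q cech_pullback_def by (intro cech_coboundariesI[of _ _ _ b]) simp_all
  then show "\<exists>\<V>\<in>open_covers X. \<exists>\<pi>. refinement_map \<V> \<U> \<pi> \<and> cech_pullback p \<V> \<pi> c \<in> cech_coboundaries \<V> p"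
    using \<V> ref by blast
qed

section \<open>Almost periodic polynomials and their closure\<close>

lemma norm_bc_mult_le: "norm (bc_mult a b) \<le> norm a * norm b"
  by (intro norm_bound) (simp add: norm_mult mult_mono norm_bounded)

lemma norm_bc_scale_le: "norm (bc_scale c a) \<le> cmod c * norm a"
  by (intro norm_bound) (simp add: norm_mult mult_left_mono norm_bounded)

lemma bounded_bilinear_bc_mult: "bounded_bilinear bc_mult"
proof
  show "\<exists>K. \<forall>a b. norm (bc_mult a b) \<le> norm a * norm b * K"
    using norm_bc_mult_le by (intro exI[of _ 1]) simp
qed (rule bcontfun_eqI, simp add: algebra_simps)+

lemma bounded_linear_bc_scale: "bounded_linear (bc_scale c)"
proof
  show "\<exists>K. \<forall>a. norm (bc_scale c a) \<le> norm a * K"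
    using norm_bc_scale_le by (intro exI[of _ "cmod c"]) (simp add: mult.commute)
qed (rule bcontfun_eqI, simp add: algebra_simps)+

lemmas tendsto_bc_mult = bounded_bilinear.tendsto[OF bounded_bilinear_bc_mult]
lemmas tendsto_bc_scale = bounded_linear.tendsto[OF bounded_linear_bc_scale]

text \<open>An almost periodic polynomial is represented by its list of pairs of a coefficient and a
  frequency.  The representation is not unique, but sums and products are simple operations on
  lists.  Replacing each exponential \<open>e\<^sub>l\<close> by a number \<open>\<theta> l\<close> gives \<open>freq_sum \<theta>\<close>: evaluation
  at a point, the Fourier coefficients and the values of characters all have this form.\<close>

definition freq_sum :: "(real \<Rightarrow> complex) \<Rightarrow> (complex \<times> real) list \<Rightarrow> complex"
  where "freq_sum \<theta> xs = (\<Sum>(c, l)\<leftarrow>xs. c * \<theta> l)"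

definition ap_poly :: "(complex \<times> real) list \<Rightarrow> (real \<Rightarrow>\<^sub>C complex)"
  where "ap_poly xs = (\<Sum>(c, l)\<leftarrow>xs. bc_scale c (ap_exp l))"

definition poly_scale :: "(real \<Rightarrow> complex) \<Rightarrow> (complex \<times> real) list \<Rightarrow> (complex \<times> real) list"
  where "poly_scale w xs = map (\<lambda>(c, l). (w l * c, l)) xs"

definition poly_mult :: "(complex \<times> real) list \<Rightarrow> (complex \<times> real) list \<Rightarrow> (complex \<times> real) list"
  where "poly_mult xs ys = concat (map (\<lambda>(c, l). map (\<lambda>(d, m). (c * d, l + m)) ys) xs)"

definition freqs :: "(complex \<times> real) list \<Rightarrow> real set"
  where "freqs xs = snd ` set xs"

lemma freq_sum_Nil [simp]: "freq_sum \<theta> [] = 0"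
  and freq_sum_Cons [simp]: "freq_sum \<theta> ((c, l) # xs) = c * \<theta> l + freq_sum \<theta> xs"
  and freq_sum_append [simp]: "freq_sum \<theta> (xs @ ys) = freq_sum \<theta> xs + freq_sum \<theta> ys"
  by (simp_all add: freq_sum_def)

lemma ap_poly_Nil [simp]: "ap_poly [] = 0"
  and ap_poly_Cons: "ap_poly ((c, l) # xs) = bc_scale c (ap_exp l) + ap_poly xs"
  by (simp_all add: ap_poly_def)

lemma freqs_simps [simp]:
  "freqs [] = {}" "freqs ((c, l) # xs) = insert l (freqs xs)" "freqs (xs @ ys) = freqs xs \<union> freqs ys"
  "freqs (poly_scale w xs) = freqs xs" "finite (freqs xs)"
  by (force simp: freqs_def poly_scale_def)+

lemma freqs_poly_mult: "freqs (poly_mult xs ys) = {l + m | l m. l \<in> freqs xs \<and> m \<in> freqs ys}"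
  by (force simp: freqs_def poly_mult_def)

lemma apply_ap_poly: "apply_bcontfun (ap_poly xs) x = freq_sum (\<lambda>l. exp (\<i> * of_real l * of_real x)) xs"
  by (induction xs) (auto simp: ap_poly_Cons)

lemma freq_sum_poly_scale: "freq_sum \<theta> (poly_scale w xs) = freq_sum (\<lambda>l. w l * \<theta> l) xs"
  by (induction xs) (auto simp: poly_scale_def)

lemma freq_sum_mult_left: "freq_sum (\<lambda>l. z * \<theta> l) xs = z * freq_sum \<theta> xs"
  by (induction xs) (auto simp: algebra_simps)

lemma freq_sum_cong: "(\<And>l. l \<in> freqs xs \<Longrightarrow> \<theta> l = \<psi> l) \<Longrightarrow> freq_sum \<theta> xs = freq_sum \<psi> xs"
  by (induction xs) auto

text \<open>This covers both the product of polynomials, where \<open>\<theta>\<close> is the exponential at a point, and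
  the multiplicativity of characters.\<close>

lemma freq_sum_poly_mult:
  assumes "\<And>l m. l \<in> freqs xs \<Longrightarrow> m \<in> freqs ys \<Longrightarrow> \<theta> (l + m) = \<theta> l * \<theta> m"
  shows "freq_sum \<theta> (poly_mult xs ys) = freq_sum \<theta> xs * freq_sum \<theta> ys"
  using assms
proof (induction xs)
  case (Cons x xs)
  obtain c l where x: "x = (c, l)"
    by fastforce
  have mult: "\<theta> (l + m) = \<theta> l * \<theta> m" if "m \<in> freqs ys" for m
    using Cons.prems that by (simp add: x)
  have "freq_sum \<theta> (map (\<lambda>(d, m). (c * d, l + m)) zs) = c * \<theta> l * freq_sum \<theta> zs"
    if "freqs zs \<subseteq> freqs ys" for zs
    using that
  proof (induction zs)
    case (Cons z zs)
    then show ?case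
      by (cases z) (simp add: mult distrib_left mult.assoc mult.left_commute)
  qed simp
  then show ?case
    using Cons by (simp add: poly_mult_def x algebra_simps)
qed (simp add: poly_mult_def)

lemma ap_poly_append: "ap_poly (xs @ ys) = ap_poly xs + ap_poly ys"
  by (simp add: ap_poly_def)

lemma ap_poly_scale: "ap_poly (poly_scale (\<lambda>_. c) xs) = bc_scale c (ap_poly xs)"
  by (rule bcontfun_eqI) (simp add: apply_ap_poly freq_sum_poly_scale freq_sum_mult_left)

lemma ap_poly_mult: "ap_poly (poly_mult xs ys) = bc_mult (ap_poly xs) (ap_poly ys)"
  by (rule bcontfun_eqI)
     (simp add: apply_ap_poly freq_sum_poly_mult exp_add algebra_simps)

lemma AP0_eq: "AP0 = range ap_poly"
proof (intro equalityI subsetI)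
  fix a assume "a \<in> AP0"
  then obtain n :: nat and r l where a: "a = (\<Sum>j<n. bc_scale (r j) (ap_exp (l j)))"
    unfolding AP0_def by blast
  have "a = ap_poly (map (\<lambda>j. (r j, l j)) [0..<n])"
    by (simp add: a ap_poly_def o_def interv_sum_list_conv_sum_set_nat atLeast0LessThan)
  then show "a \<in> range ap_poly"
    by blast
next
  fix a assume "a \<in> range ap_poly"
  then obtain xs where "a = ap_poly xs"
    by blast
  then have "a = (\<Sum>j<length xs. bc_scale (fst (xs ! j)) (ap_exp (snd (xs ! j))))"
    by (simp add: ap_poly_def sum_list_sum_nth atLeast0LessThan case_prod_beta)
  then show "a \<in> AP0"
    unfolding AP0_def by (intro CollectI exI)
qed

lemma bohr_mean_exp:
  "((\<lambda>N::real. complex_of_real (1 / (2 * N)) * integral {-N..N} (\<lambda>x. exp (\<i> * of_real \<nu> * of_real x)))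
     \<longlongrightarrow> (if \<nu> = 0 then 1 else 0)) at_top"
proof (cases "\<nu> = 0")
  case True
  have "complex_of_real (1 / (2 * N)) * integral {-N..N} (\<lambda>x. exp (\<i> * of_real \<nu> * of_real x)) = 1" if "N > 0" for N
    using that by (simp add: True scaleR_conv_of_real)
  then show ?thesis
    using True by (intro tendsto_eventually eventually_mono[OF eventually_gt_at_top[of 0]]) simp
next
  case False
  have int: "integral {-N..N} (\<lambda>x. exp (\<i> * of_real \<nu> * of_real x)) =
      (exp (\<i> * of_real \<nu> * of_real N) - exp (\<i> * of_real \<nu> * of_real (-N))) / (\<i> * of_real \<nu>)"
    if "N > 0" for N
  proof -
    have "((\<lambda>x. exp (\<i> * of_real \<nu> * of_real x)) has_integral
        (exp (\<i> * of_real \<nu> * of_real N) / (\<i> * of_real \<nu>)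
          - exp (\<i> * of_real \<nu> * of_real (-N)) / (\<i> * of_real \<nu>))) {-N..N}"
    proof (rule fundamental_theorem_of_calculus)
      fix x
      have "((\<lambda>z. exp (\<i> * of_real \<nu> * z) / (\<i> * of_real \<nu>)) has_field_derivative
          exp (\<i> * of_real \<nu> * of_real x)) (at (of_real x))"
        using False by (auto intro!: derivative_eq_intros)
      then show "((\<lambda>x. exp (\<i> * of_real \<nu> * of_real x) / (\<i> * of_real \<nu>)) has_vector_derivative
          exp (\<i> * of_real \<nu> * of_real x)) (at x within {-N..N})"
        by (rule has_vector_derivative_real_field)
    qed (use that in simp)
    then show ?thesis
      by (simp add: integral_unique diff_divide_distrib)
  qed
  have "norm (complex_of_real (1 / (2 * N)) * integral {-N..N} (\<lambda>x. exp (\<i> * of_real \<nu> * of_real x)))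
      \<le> inverse N * (1 / \<bar>\<nu>\<bar>)" if "N > 0" for N
  proof -
    have "norm (exp (\<i> * of_real \<nu> * of_real N) - exp (\<i> * of_real \<nu> * of_real (-N))) \<le> 1 + 1"
      by (rule norm_triangle_le_diff) (simp add: norm_exp_eq_Re)
    then have "norm (integral {-N..N} (\<lambda>x. exp (\<i> * of_real \<nu> * of_real x))) \<le> 2 / \<bar>\<nu>\<bar>"
      using that by (simp add: int norm_divide norm_mult divide_right_mono)
    then have "inverse (2 * N) * norm (integral {-N..N} (\<lambda>x. exp (\<i> * of_real \<nu> * of_real x)))
        \<le> inverse (2 * N) * (2 / \<bar>\<nu>\<bar>)"
      using that by (intro mult_left_mono) auto
    moreover have "norm (complex_of_real (1 / (2 * N))) = inverse (2 * N)"
      using that by (simp add: norm_divide inverse_eq_divide)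
    moreover have "inverse (2 * N) * (2 / \<bar>\<nu>\<bar>) = inverse N * (1 / \<bar>\<nu>\<bar>)"
      by simp
    ultimately show ?thesis
      unfolding norm_mult by (simp only:)
  qed
  moreover have "((\<lambda>N::real. inverse N * (1 / \<bar>\<nu>\<bar>)) \<longlongrightarrow> 0) at_top"
    by (intro tendsto_mult_left_zero tendsto_inverse_0_at_top filterlim_ident)
  ultimately have "((\<lambda>N::real. complex_of_real (1 / (2 * N)) *
      integral {-N..N} (\<lambda>x. exp (\<i> * of_real \<nu> * of_real x))) \<longlongrightarrow> 0) at_top"
    by (rule Lim_null_comparison[OF eventually_mono[OF eventually_gt_at_top[of 0]]])
  then show ?thesis
    using False by simp
qed

text \<open>The Fourier coefficient at \<open>\<mu>\<close>: the coefficient of \<open>e\<^sub>\<mu>\<close> after terms with equal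
  frequency have been collected.\<close>

definition freq_coeff :: "(complex \<times> real) list \<Rightarrow> real \<Rightarrow> complex"
  where "freq_coeff xs \<mu> = freq_sum (\<lambda>l. if l = \<mu> then 1 else 0) xs"

lemma bohr_mean_ap_poly:
  "((\<lambda>N::real. complex_of_real (1 / (2 * N)) *
      integral {-N..N} (\<lambda>x. apply_bcontfun (ap_poly xs) x * apply_bcontfun (ap_exp (-\<mu>)) x))
    \<longlongrightarrow> freq_coeff xs \<mu>) at_top"
proof (induction xs)
  case (Cons x xs)
  obtain c l where x: "x = (c, l)"
    by fastforce
  let ?f = "\<lambda>x. exp (\<i> * of_real (l - \<mu>) * complex_of_real x)"
  let ?g = "\<lambda>x. apply_bcontfun (ap_poly xs) x * apply_bcontfun (ap_exp (-\<mu>)) x"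
  have f: "?f integrable_on {-N..N}" and g: "?g integrable_on {-N..N}" for N
    by (intro integrable_continuous_interval continuous_intros continuous_on_apply_bcontfun)+
  have "apply_bcontfun (ap_poly ((c, l) # xs)) x * apply_bcontfun (ap_exp (-\<mu>)) x = c * ?f x + ?g x" for x
    by (simp add: ap_poly_Cons algebra_simps exp_add exp_diff exp_minus divide_inverse)
  then have "integral {-N..N} (\<lambda>x. apply_bcontfun (ap_poly ((c, l) # xs)) x * apply_bcontfun (ap_exp (-\<mu>)) x)
     = c * integral {-N..N} ?f + integral {-N..N} ?g" for N
    using f[of N] g[of N] by (simp add: integral_add integrable_on_mult_right del: apply_ap_exp of_real_diff)
  then have eq: "complex_of_real (1 / (2 * N)) *
      integral {-N..N} (\<lambda>x. apply_bcontfun (ap_poly ((c, l) # xs)) x * apply_bcontfun (ap_exp (-\<mu>)) x)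
     = c * (complex_of_real (1 / (2 * N)) * integral {-N..N} ?f)
       + complex_of_real (1 / (2 * N)) * integral {-N..N} ?g" for N
    by (simp add: algebra_simps del: apply_ap_exp of_real_diff)
  have "freq_coeff ((c, l) # xs) \<mu> = c * (if l - \<mu> = 0 then 1 else 0) + freq_coeff xs \<mu>"
    by (simp add: freq_coeff_def)
  then show ?case
    unfolding x eq by (simp only:) (intro tendsto_add tendsto_mult_left bohr_mean_exp Cons.IH)
qed (simp add: freq_coeff_def)

lemma bohr_spectrum_ap_poly: "\<Omega> (ap_poly xs) = {\<mu>. freq_coeff xs \<mu> \<noteq> 0}"
  unfolding bohr_spectrum_def
  using bohr_mean_ap_poly tendsto_unique[OF trivial_limit_at_top_linorder] by blast

lemma freq_coeff_eq_0: "\<mu> \<notin> freqs xs \<Longrightarrow> freq_coeff xs \<mu> = 0"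
  unfolding freq_coeff_def by (induction xs) auto

lemma freq_sum_collect:
  assumes "finite S" "freqs xs \<subseteq> S"
  shows "freq_sum \<theta> xs = (\<Sum>l\<in>S. freq_coeff xs l * \<theta> l)"
  using assms(2)
proof (induction xs)
  case (Cons x xs)
  obtain c m where x: "x = (c, m)"
    by fastforce
  have "(\<Sum>l\<in>S. freq_coeff (x # xs) l * \<theta> l) = (\<Sum>l\<in>S. (if m = l then c * \<theta> l else 0) + freq_coeff xs l * \<theta> l)"
    by (intro sum.cong) (auto simp: freq_coeff_def x algebra_simps)
  also have "\<dots> = c * \<theta> m + freq_sum \<theta> xs"
    using Cons assms(1) by (simp add: sum.distrib x)
  finally show ?case
    by (simp add: x)
qed (simp add: freq_coeff_def)

text \<open>The spectrum of a polynomial consists of the frequencies that remain after collecting terms and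
  deleting those with coefficient zero.\<close>

lemma AP0_semi_eq: "AP0_semi \<Sigma> = ap_poly ` {xs. freqs xs \<subseteq> \<Sigma>}"
proof (intro equalityI subsetI)
  fix a assume "a \<in> AP0_semi \<Sigma>"
  then obtain xs where a: "a = ap_poly xs" and \<Sigma>: "{\<mu>. freq_coeff xs \<mu> \<noteq> 0} \<subseteq> \<Sigma>"
    by (auto simp: AP0_semi_def AP0_eq bohr_spectrum_ap_poly)
  define S where "S = {\<mu>. freq_coeff xs \<mu> \<noteq> 0}"
  have "S \<subseteq> freqs xs"
    using freq_coeff_eq_0 by (force simp: S_def)
  then have "finite S"
    using finite_subset freqs_simps(5) by blast
  then obtain ls where ls: "set ls = S" "distinct ls"
    using finite_distinct_list by blast
  let ?ys = "map (\<lambda>l. (freq_coeff xs l, l)) ls"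
  have "freq_sum \<theta> xs = freq_sum \<theta> ?ys" for \<theta>
  proof -
    have "freq_sum \<theta> xs = (\<Sum>l\<in>freqs xs. freq_coeff xs l * \<theta> l)"
      by (rule freq_sum_collect) auto
    also have "\<dots> = (\<Sum>l\<in>S. freq_coeff xs l * \<theta> l)"
      using \<open>S \<subseteq> freqs xs\<close> by (intro sum.mono_neutral_right) (auto simp: S_def)
    also have "\<dots> = freq_sum \<theta> ?ys"
      using ls by (simp add: freq_sum_def o_def sum_list_distinct_conv_sum_set)
    finally show ?thesis .
  qed
  then have "a = ap_poly ?ys"
    by (intro bcontfun_eqI) (simp add: a apply_ap_poly)
  moreover have "freqs ?ys \<subseteq> \<Sigma>"
    using ls \<Sigma> by (auto simp: freqs_def S_def)
  ultimately show "a \<in> ap_poly ` {xs. freqs xs \<subseteq> \<Sigma>}"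
    by blast
next
  fix a assume "a \<in> ap_poly ` {xs. freqs xs \<subseteq> \<Sigma>}"
  then show "a \<in> AP0_semi \<Sigma>"
    using freq_coeff_eq_0 by (force simp: AP0_semi_def AP0_eq bohr_spectrum_ap_poly)
qed

lemma closed_subalgebra_AP: "closed_subalgebra AP"
  unfolding AP_def closed_subalgebra_def by (auto intro!: closed_Inter)

lemma AP0_subset_AP: "AP0 \<subseteq> AP"
proof -
  have "ap_poly xs \<in> AP" for xs
  proof (induction xs)
    case (Cons x xs)
    have "ap_exp (snd x) \<in> AP"
      by (auto simp: AP_def)
    then show ?case
      using Cons closed_subalgebra_AP by (cases x) (simp add: ap_poly_Cons closed_subalgebra_def)
  qed (use closed_subalgebra_AP in \<open>simp add: closed_subalgebra_def\<close>)
  then show ?thesis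
    by (auto simp: AP0_eq)
qed

lemma AP_semi_eq: "AP_semi \<Sigma> = closure (AP0_semi \<Sigma>)"
proof -
  have "closure (AP0_semi \<Sigma>) \<subseteq> AP"
    using AP0_subset_AP closed_subalgebra_AP
    by (intro closure_minimal) (auto simp: AP0_semi_def closed_subalgebra_def)
  then show ?thesis
    by (auto simp: AP_semi_def)
qed

lemma AP_semi_limit:
  assumes "a \<in> AP_semi \<Sigma>"
  obtains X where "\<And>n. freqs (X n) \<subseteq> \<Sigma>" "(\<lambda>n. ap_poly (X n)) \<longlonglongrightarrow> a"
proof -
  obtain p where p: "\<And>n. p n \<in> AP0_semi \<Sigma>" "p \<longlonglongrightarrow> a"
    using assms unfolding AP_semi_eq closure_sequential by blast
  have "\<exists>X. \<forall>n. p n = ap_poly (X n) \<and> freqs (X n) \<subseteq> \<Sigma>"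
    using p(1) unfolding AP0_semi_eq by (intro choice) auto
  then obtain X where X: "\<And>n. p n = ap_poly (X n)" "\<And>n. freqs (X n) \<subseteq> \<Sigma>"
    by auto
  have "p = (\<lambda>n. ap_poly (X n))"
    using X(1) by (rule ext)
  with p(2) have "(\<lambda>n. ap_poly (X n)) \<longlonglongrightarrow> a"
    by (simp only:)
  with X(2) show ?thesis
    by (rule that)
qed

lemma ap_poly_in_AP_semi: "freqs xs \<subseteq> \<Sigma> \<Longrightarrow> ap_poly xs \<in> AP_semi \<Sigma>"
  unfolding AP_semi_eq AP0_semi_eq by (rule subsetD[OF closure_subset]) simp

lemma AP_semi_limitI: "(\<And>n. freqs (X n) \<subseteq> \<Sigma>) \<Longrightarrow> (\<lambda>n. ap_poly (X n)) \<longlonglongrightarrow> a \<Longrightarrow> a \<in> AP_semi \<Sigma>"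
proof (rule closed_sequentially[of "AP_semi \<Sigma>" "\<lambda>n. ap_poly (X n)"])
  show "closed (AP_semi \<Sigma>)"
    by (simp add: AP_semi_eq)
qed (rule ap_poly_in_AP_semi)

lemma closed_subalgebra_AP_semi:
  assumes add: "\<And>l m. l \<in> \<Sigma> \<Longrightarrow> m \<in> \<Sigma> \<Longrightarrow> l + m \<in> \<Sigma>"
  shows "closed_subalgebra (AP_semi \<Sigma>)"
  unfolding closed_subalgebra_def
proof (intro conjI ballI allI)
  show "closed (AP_semi \<Sigma>)"
    by (simp add: AP_semi_eq)
  show "0 \<in> AP_semi \<Sigma>"
    using ap_poly_in_AP_semi[of "[]"] by simp
next
  fix a b assume "a \<in> AP_semi \<Sigma>" "b \<in> AP_semi \<Sigma>"
  then obtain X Y where X: "\<And>n. freqs (X n) \<subseteq> \<Sigma>" "(\<lambda>n. ap_poly (X n)) \<longlonglongrightarrow> a"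
    and Y: "\<And>n. freqs (Y n) \<subseteq> \<Sigma>" "(\<lambda>n. ap_poly (Y n)) \<longlonglongrightarrow> b"
    by (elim AP_semi_limit) blast
  show "a + b \<in> AP_semi \<Sigma>"
    using X Y by (intro AP_semi_limitI[of "\<lambda>n. X n @ Y n"]) (auto simp: ap_poly_append intro!: tendsto_add)
  show "bc_mult a b \<in> AP_semi \<Sigma>"
  proof (rule AP_semi_limitI[of "\<lambda>n. poly_mult (X n) (Y n)"])
    show "freqs (poly_mult (X n) (Y n)) \<subseteq> \<Sigma>" for n
      using X(1)[of n] Y(1)[of n] add by (auto simp: freqs_poly_mult)
    show "(\<lambda>n. ap_poly (poly_mult (X n) (Y n))) \<longlonglongrightarrow> bc_mult a b"
      unfolding ap_poly_mult by (intro tendsto_bc_mult X Y)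
  qed
next
  fix c a assume "a \<in> AP_semi \<Sigma>"
  then obtain X where X: "\<And>n. freqs (X n) \<subseteq> \<Sigma>" "(\<lambda>n. ap_poly (X n)) \<longlonglongrightarrow> a"
    by (elim AP_semi_limit) blast
  then show "bc_scale c a \<in> AP_semi \<Sigma>"
    by (intro AP_semi_limitI[of "\<lambda>n. poly_scale (\<lambda>_. c) (X n)"]) (auto simp: ap_poly_scale intro!: tendsto_bc_scale)
qed

lemma ap_poly_singleton: "ap_poly [(1, l)] = ap_exp l"
  by (rule bcontfun_eqI) (simp add: apply_ap_poly)

lemma ap_exp_in_AP_semi: "l \<in> \<Sigma> \<Longrightarrow> ap_exp l \<in> AP_semi \<Sigma>"
  using ap_poly_in_AP_semi[of "[(1, l)]"] by (simp add: ap_poly_singleton)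

section \<open>Characters and the maximal ideal space\<close>

lemma character_add: "\<phi> \<in> nonzero_characters A \<Longrightarrow> a \<in> A \<Longrightarrow> b \<in> A \<Longrightarrow> \<phi> (a + b) = \<phi> a + \<phi> b"
  and character_scale: "\<phi> \<in> nonzero_characters A \<Longrightarrow> a \<in> A \<Longrightarrow> \<phi> (bc_scale c a) = c * \<phi> a"
  and character_mult: "\<phi> \<in> nonzero_characters A \<Longrightarrow> a \<in> A \<Longrightarrow> b \<in> A \<Longrightarrow> \<phi> (bc_mult a b) = \<phi> a * \<phi> b"
  and character_extensional: "\<phi> \<in> nonzero_characters A \<Longrightarrow> \<phi> \<in> extensional A"
  by (simp_all add: nonzero_characters_def)

lemma bc_mult_unit: "bc_mult a (ap_exp 0) = a"
  by (rule bcontfun_eqI) simp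

lemma character_unit:
  assumes "\<phi> \<in> nonzero_characters A" "ap_exp 0 \<in> A"
  shows "\<phi> (ap_exp 0) = 1"
proof -
  obtain a where a: "a \<in> A" "\<phi> a \<noteq> 0"
    using assms(1) unfolding nonzero_characters_def by blast
  have "\<phi> a * \<phi> (ap_exp 0) = \<phi> a"
    using character_mult[OF assms(1) a(1) assms(2)] by (simp add: bc_mult_unit)
  then show ?thesis
    using a(2) by simp
qed

text \<open>Characters are automatically contractive: if \<open>norm b < 1\<close> and \<open>\<phi> b = 1\<close>, then
  the solution \<open>x\<close> of \<open>x = b + b x\<close>, which exists by the contraction principle, would satisfy
  \<open>\<phi> x = 1 + \<phi> x\<close>.\<close>

lemma character_norm_le:
  assumes A: "closed_subalgebra A" and \<phi>: "\<phi> \<in> nonzero_characters A" and a: "a \<in> A"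
  shows "cmod (\<phi> a) \<le> norm a"
proof (rule ccontr)
  assume "\<not> ?thesis"
  then have less: "norm a < cmod (\<phi> a)"
    by simp
  then have "\<phi> a \<noteq> 0"
    using norm_ge_zero[of a] by auto
  define b where "b = bc_scale (1 / \<phi> a) a"
  have b: "b \<in> A" "\<phi> b = 1"
    using A a \<phi> \<open>\<phi> a \<noteq> 0\<close> by (auto simp: b_def closed_subalgebra_def character_scale)
  have "norm b \<le> norm a / cmod (\<phi> a)"
    using norm_bc_scale_le[of "1 / \<phi> a" a] by (simp add: b_def norm_divide)
  also have "\<dots> < 1"
    using less \<open>\<phi> a \<noteq> 0\<close> by simp
  finally have "norm b < 1" .
  have "\<exists>!x. x \<in> A \<and> b + bc_mult b x = x"
  proof (rule Banach_fix)
    show "complete A"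
      using A by (simp add: closed_subalgebra_def complete_eq_closed)
    show "(\<lambda>x. b + bc_mult b x) ` A \<subseteq> A"
      using A b(1) by (auto simp: closed_subalgebra_def)
    show "dist (b + bc_mult b x) (b + bc_mult b y) \<le> norm b * dist x y" for x y
      using norm_bc_mult_le[of b "x - y"]
      by (simp add: dist_norm bounded_bilinear.diff_right[OF bounded_bilinear_bc_mult])
  qed (use b(1) \<open>norm b < 1\<close> in auto)
  then obtain x where x: "x \<in> A" "b + bc_mult b x = x"
    by blast
  have "bc_mult b x \<in> A"
    using A b(1) x(1) by (simp add: closed_subalgebra_def)
  then have "\<phi> (b + bc_mult b x) = 1 + \<phi> x"
    using character_add[OF \<phi> b(1)] character_mult[OF \<phi> b(1) x(1)] b(2) by simp
  then show False
    by (simp add: x(2))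
qed

text \<open>The characters form a closed subset of a product of discs.  In the algebra with unit
  \<open>ap_exp 0\<close> the condition of being nonzero is replaced by the closed condition of mapping the
  unit to \<open>1\<close>.\<close>

lemma compact_maximal_ideal_space:
  assumes A: "closed_subalgebra A" and unit: "ap_exp 0 \<in> A"
  shows "compact_space (maximal_ideal_space A)"
proof -
  let ?P = "product_topology (\<lambda>_. euclidean :: complex topology) A"
  let ?K = "PiE A (\<lambda>a. cball 0 (norm a))"
  have eval: "continuous_map ?P euclidean (\<lambda>\<phi>. \<phi> a)" if "a \<in> A" for a
    using that by (rule continuous_map_product_projection)
  have closed_eq: "closedin ?P {\<phi> \<in> topspace ?P. f \<phi> = g \<phi>}"
    if "continuous_map ?P euclidean f" "continuous_map ?P euclidean g" for f g :: "_ \<Rightarrow> complex"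
    using that by (intro closedin_continuous_maps_eq[of euclidean]) (auto simp: Hausdorff_space_euclidean)
  have mult: "continuous_map ?P euclidean (\<lambda>\<phi>. f \<phi> * g \<phi>)"
    if "continuous_map ?P euclidean f" "continuous_map ?P euclidean g" for f g :: "_ \<Rightarrow> complex"
    using that by (simp add: continuous_map_atin tendsto_mult)
  have cl: "a + b \<in> A" "bc_mult a b \<in> A" "bc_scale c a \<in> A" if "a \<in> A" "b \<in> A" for a b c
    using A that by (auto simp: closed_subalgebra_def)
  define C1 where "C1 = (\<Inter>a\<in>A. \<Inter>b\<in>A. {\<phi> \<in> topspace ?P. \<phi> (a + b) = \<phi> a + \<phi> b})"
  define C2 where "C2 = (\<Inter>a\<in>A. \<Inter>c. {\<phi> \<in> topspace ?P. \<phi> (bc_scale c a) = c * \<phi> a})"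
  define C3 where "C3 = (\<Inter>a\<in>A. \<Inter>b\<in>A. {\<phi> \<in> topspace ?P. \<phi> (bc_mult a b) = \<phi> a * \<phi> b})"
  define C4 where "C4 = {\<phi> \<in> topspace ?P. \<phi> (ap_exp 0) = 1}"
  have "A \<noteq> {}"
    using unit by blast
  have "closedin ?P C1" "closedin ?P C2" "closedin ?P C3" "closedin ?P C4"
    unfolding C1_def C2_def C3_def C4_def using \<open>A \<noteq> {}\<close> unit
    by (intro closedin_INT closed_eq continuous_map_add mult eval cl continuous_map_const[THEN iffD2]; simp)+
  then have "closedin ?P (C1 \<inter> C2 \<inter> C3 \<inter> C4)"
    by (intro closedin_Int)
  moreover have "nonzero_characters A = C1 \<inter> C2 \<inter> C3 \<inter> C4"
  proof (intro equalityI subsetI)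
    fix \<phi> assume "\<phi> \<in> nonzero_characters A"
    then show "\<phi> \<in> C1 \<inter> C2 \<inter> C3 \<inter> C4"
      using character_unit[OF _ unit]
      by (auto simp: C1_def C2_def C3_def C4_def nonzero_characters_def PiE_def)
  next
    fix \<phi> assume \<phi>: "\<phi> \<in> C1 \<inter> C2 \<inter> C3 \<inter> C4"
    then have "\<phi> (ap_exp 0) \<noteq> 0"
      by (auto simp: C4_def)
    then show "\<phi> \<in> nonzero_characters A"
      using \<phi> bexI[of "\<lambda>a. \<phi> a \<noteq> 0", OF _ unit] unfolding nonzero_characters_def
      by (auto simp: C1_def C2_def C3_def C4_def PiE_def)
  qed
  ultimately have "closedin ?P (nonzero_characters A)"
    by simp
  moreover have "compactin ?P ?K"
    by (simp add: compactin_PiE)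
  moreover have "nonzero_characters A \<subseteq> ?K"
  proof (intro subsetI PiE_I)
    show "\<phi> a \<in> cball 0 (norm a)" if "\<phi> \<in> nonzero_characters A" "a \<in> A" for \<phi> a
      using character_norm_le[OF A that] by simp
    show "\<phi> a = undefined" if "\<phi> \<in> nonzero_characters A" "a \<notin> A" for \<phi> a
      using extensional_arb[OF character_extensional] that by metis
  qed
  ultimately have "compactin ?P (nonzero_characters A)"
    using closed_compactin by blast
  then show ?thesis
    unfolding maximal_ideal_space_def by (rule compact_space_subtopology)
qed

lemma topspace_maximal_ideal_space: "topspace (maximal_ideal_space A) = nonzero_characters A"
  unfolding maximal_ideal_space_def using character_extensional by (auto simp: PiE_def)

section \<open>Damping of frequencies\<close>

lemma norm_freq_sum_le: "(\<And>l. l \<in> freqs xs \<Longrightarrow> cmod (w l) \<le> 1) \<Longrightarrow> cmod (freq_sum w xs) \<le> (\<Sum>(c, l)\<leftarrow>xs. cmod c)"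
proof (induction xs)
  case (Cons x xs)
  obtain c l where x: "x = (c, l)"
    by fastforce
  have "cmod (c * w l) \<le> cmod c * 1"
    unfolding norm_mult using Cons.prems by (intro mult_left_mono) (auto simp: x)
  then show ?case
    using Cons by (auto simp: x intro!: norm_triangle_le)
qed simp

text \<open>A polynomial with nonnegative frequencies extends to a bounded holomorphic function \<open>F\<close> on the
  upper half-plane, and a Phragmen-Lindelof argument bounds \<open>F\<close> by its supremum on the real line:
  division by \<open>1 - \<i> e z\<close>, which has modulus at least \<open>1\<close> there, forces decay at infinity, so
  the maximum principle on large half-discs applies; then \<open>e\<close> tends to \<open>0\<close>.\<close>

lemma upper_half_plane_bound:
  assumes pos: "freqs xs \<subseteq> {0..}" and z: "Im z \<ge> 0"
  shows "cmod (freq_sum (\<lambda>l. exp (\<i> * of_real l * z)) xs) \<le> norm (ap_poly xs)"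
proof -
  define F where "F z = freq_sum (\<lambda>l. exp (\<i> * of_real l * z)) xs" for z
  define B where "B = norm (ap_poly xs)"
  define C where "C = (\<Sum>(c, l)\<leftarrow>xs. cmod c)"
  have F_real: "cmod (F z) \<le> B" if "Im z = 0" for z
  proof -
    have "z = of_real (Re z)"
      using that by (simp add: complex_eq_iff)
    then have "F z = apply_bcontfun (ap_poly xs) (Re z)"
      unfolding F_def apply_ap_poly by simp
    then show ?thesis
      unfolding B_def by (simp only: norm_bounded)
  qed
  have F_upper: "cmod (F z) \<le> C" if "Im z \<ge> 0" for z
    unfolding F_def C_def using that pos by (intro norm_freq_sum_le) (auto simp: norm_exp_eq_Re)
  have holF: "F holomorphic_on S" for S
    unfolding F_def
  proof (induction xs)
    case (Cons x xs)
    then show ?case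
      by (cases x) (auto intro!: holomorphic_intros)
  qed simp
  have "C \<ge> 0"
    unfolding C_def by (intro sum_list_nonneg) auto
  have damped: "cmod (F z) \<le> (B + e) * cmod (1 - \<i> * of_real e * z)" if e: "e > 0" for e
  proof -
    define g where "g w = F w / (1 - \<i> * of_real e * w)" for w
    have den1: "cmod (1 - \<i> * of_real e * w) \<ge> 1" if "Im w \<ge> 0" for w
    proof -
      have "1 \<le> Re (1 - \<i> * of_real e * w)"
        using that e by simp
      then show ?thesis
        using complex_Re_le_cmod order_trans by blast
    qed
    \<comment> \<open>On \<open>cmod w = R\<close> the denominator has modulus at least \<open>e R - 1\<close>, so this \<open>R\<close> makes the quotient at most \<open>e\<close>.\<close>
    define R where "R = max (cmod z + 1) ((C / e + 1) / e)"
    have R: "cmod z < R"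
      by (simp add: R_def less_max_iff_disj)
    have "(C / e + 1) / e \<le> R"
      by (simp add: R_def)
    then have eR: "C / e + 1 \<le> e * R"
      using e by (simp only: pos_divide_le_eq mult.commute)
    define S where "S = cball 0 R \<inter> {w. 0 \<le> Im w}"
    have "closed S"
      unfolding S_def by (intro closed_Int closed_cball closed_halfspace_Im_ge)
    have holg: "g holomorphic_on S"
      unfolding g_def
      by (intro holomorphic_intros holF) (use den1 in \<open>force simp: S_def\<close>)
    have "cmod (g z) \<le> B + e"
    proof (rule maximum_modulus_frontier[of g S])
      show "g holomorphic_on interior S"
        using holg holomorphic_on_subset interior_subset by blast
      show "continuous_on (closure S) g"
        using holg \<open>closed S\<close> by (simp add: holomorphic_on_imp_continuous_on)
      show "bounded S"
        unfolding S_def by (intro bounded_Int) simp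
      show "z \<in> S"
        using z R by (simp add: S_def)
      fix w assume "w \<in> frontier S"
      then have w: "w \<in> S" "w \<notin> interior S"
        using \<open>closed S\<close> by (auto simp: frontier_def)
      have "open (ball 0 R \<inter> {w. 0 < Im w})" "ball 0 R \<inter> {w. 0 < Im w} \<subseteq> S"
        by (auto simp: S_def open_halfspace_Im_gt)
      then have "w \<notin> ball 0 R \<inter> {w. 0 < Im w}"
        using w(2) interior_maximal by blast
      then have "Im w = 0 \<or> cmod w = R"
        using w(1) by (auto simp: S_def)
      then show "cmod (g w) \<le> B + e"
      proof
        assume "Im w = 0"
        have "cmod (g w) \<le> cmod (F w) / 1"
          unfolding g_def norm_divide using den1[of w] \<open>Im w = 0\<close> by (intro divide_left_mono) auto
        then show ?thesis
          using F_real[OF \<open>Im w = 0\<close>] e by simp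
      next
        assume "cmod w = R"
        have "C / e + 1 \<le> cmod (\<i> * of_real e * w)"
          using eR e \<open>cmod w = R\<close> by (simp add: norm_mult)
        then have "C / e \<le> cmod (1 - \<i> * of_real e * w)"
          using norm_triangle_ineq3[of "\<i> * of_real e * w" 1] by (simp add: norm_minus_commute)
        then have "C \<le> e * cmod (1 - \<i> * of_real e * w)"
          using e by (simp add: field_simps)
        moreover have "cmod (F w) \<le> C"
          using F_upper w(1) by (simp add: S_def)
        ultimately have "cmod (g w) \<le> e"
          unfolding g_def norm_divide using den1[of w] w(1) by (auto simp: S_def divide_le_eq)
        then show ?thesis
          unfolding B_def by (simp add: add_increasing)
      qed
    qed
    then show ?thesis
      using den1[OF z] by (simp add: g_def norm_divide divide_le_eq split: if_splits)
  qed
  have "((\<lambda>e. (B + e) * cmod (1 - \<i> * of_real e * z)) \<longlongrightarrow> (B + 0) * cmod (1 - \<i> * of_real 0 * z)) (at_right 0)"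
    by (intro tendsto_intros)
  moreover have "\<forall>\<^sub>F e in at_right 0. cmod (F z) \<le> (B + e) * cmod (1 - \<i> * of_real e * z)"
    using damped by (auto intro: eventually_at_right_less[THEN eventually_mono])
  ultimately have "cmod (F z) \<le> (B + 0) * cmod (1 - \<i> * of_real 0 * z)"
    by (rule tendsto_lowerbound) simp
  then show ?thesis
    by (simp add: F_def B_def)
qed

text \<open>The factor \<open>r\<^sup>l\<close> with the convention that \<open>0\<^sup>0 = 1\<close>; the function \<open>powr\<close> has the value \<open>0\<close>
  there.  For \<open>r = exp (-t)\<close> this is the factor by which the translation \<open>x \<mapsto> x + \<i> t\<close>
  multiplies \<open>e\<^sub>l\<close>.\<close>

definition damping :: "real \<Rightarrow> real \<Rightarrow> real"
  where "damping r l = (if l = 0 then 1 else r powr l)"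

lemma damping_add: "l \<ge> 0 \<Longrightarrow> m \<ge> 0 \<Longrightarrow> damping r (l + m) = damping r l * damping r m"
  by (auto simp: damping_def powr_add)

lemma damping_1 [simp]: "damping 1 l = 1"
  by (simp add: damping_def)

lemma damping_0: "damping 0 l = (if l = 0 then 1 else 0)"
  by (simp add: damping_def)

lemma continuous_on_damping: "l \<ge> 0 \<Longrightarrow> continuous_on {0..1} (\<lambda>r. damping r l)"
  unfolding damping_def by (cases "l = 0") (auto intro!: continuous_on_powr')

text \<open>Damping by \<open>r\<close> restricts the holomorphic extension to the line at height \<open>- ln r \<ge> 0\<close>,
  where \<open>upper_half_plane_bound\<close> applies.\<close>

lemma norm_damped_poly_le:
  assumes pos: "freqs xs \<subseteq> {0..}" and r: "0 < r" "r \<le> 1"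
  shows "norm (ap_poly (poly_scale (\<lambda>l. of_real (damping r l)) xs)) \<le> norm (ap_poly xs)"
proof (rule norm_bound)
  fix x
  define z where "z = Complex x (- ln r)"
  have "of_real (damping r l) * exp (\<i> * of_real l * of_real x) = exp (\<i> * of_real l * z)" for l
  proof -
    have "\<i> * of_real l * z = of_real (l * ln r) + \<i> * of_real l * of_real x"
      by (simp add: z_def complex_eq_iff)
    moreover have "damping r l = exp (l * ln r)"
      using r by (simp add: damping_def powr_def)
    ultimately show ?thesis
      by (simp add: exp_add exp_of_real del: of_real_mult)
  qed
  moreover have "Im z \<ge> 0"
    using r by (simp add: z_def)
  ultimately show "norm (apply_bcontfun (ap_poly (poly_scale (\<lambda>l. of_real (damping r l)) xs)) x) \<le> norm (ap_poly xs)"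
    using upper_half_plane_bound[OF pos, of z] by (simp only: apply_ap_poly freq_sum_poly_scale)
qed

section \<open>The contraction of the maximal ideal space\<close>

lemma character_norm_diff_le:
  assumes A: "closed_subalgebra A" and \<phi>: "\<phi> \<in> nonzero_characters A" and "a \<in> A" "b \<in> A"
  shows "cmod (\<phi> a - \<phi> b) \<le> norm (a - b)"
proof -
  have neg: "bc_scale (-1) b \<in> A"
    using A assms(4) by (simp add: closed_subalgebra_def)
  have eq: "a - b = a + bc_scale (-1) b"
    by (rule bcontfun_eqI) simp
  have "\<phi> (a - b) = \<phi> a - \<phi> b"
    unfolding eq by (simp add: character_add[OF \<phi> assms(3) neg] character_scale[OF \<phi> assms(4)])
  moreover have "a - b \<in> A"
    unfolding eq using A assms(3) neg by (simp add: closed_subalgebra_def)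
  ultimately show ?thesis
    using character_norm_le[OF A \<phi>] by metis
qed

locale additive_frequencies =
  fixes \<Sigma> :: "real set"
  assumes nonneg: "\<Sigma> \<subseteq> {0..}"
    and add_closed: "\<And>l m. l \<in> \<Sigma> \<Longrightarrow> m \<in> \<Sigma> \<Longrightarrow> l + m \<in> \<Sigma>"
    and zero_mem: "0 \<in> \<Sigma>"
begin

abbreviation "characters \<equiv> nonzero_characters (AP_semi \<Sigma>)"

lemma closed_subalgebra: "closed_subalgebra (AP_semi \<Sigma>)"
  using add_closed by (rule closed_subalgebra_AP_semi)

lemma unit_mem: "ap_exp 0 \<in> AP_semi \<Sigma>"
  using zero_mem by (rule ap_exp_in_AP_semi)

lemma character_ap_poly:
  assumes \<phi>: "\<phi> \<in> characters" and "freqs xs \<subseteq> \<Sigma>"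
  shows "\<phi> (ap_poly xs) = freq_sum (\<lambda>l. \<phi> (ap_exp l)) xs"
  using assms(2)
proof (induction xs)
  case Nil
  have "\<phi> (bc_scale 0 (ap_exp 0)) = 0"
    using character_scale[OF \<phi> unit_mem] by simp
  moreover have "bc_scale 0 (ap_exp 0) = 0"
    by (rule bcontfun_eqI) simp
  ultimately show ?case
    by simp
next
  case (Cons x xs)
  obtain c l where x: "x = (c, l)"
    by fastforce
  have l: "ap_exp l \<in> AP_semi \<Sigma>" and xs: "freqs xs \<subseteq> \<Sigma>"
    using Cons.prems by (auto simp: x ap_exp_in_AP_semi)
  have "bc_scale c (ap_exp l) \<in> AP_semi \<Sigma>"
    using closed_subalgebra l by (simp add: closed_subalgebra_def)
  then show ?case
    using Cons.IH[OF xs] ap_poly_in_AP_semi[OF xs]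
    by (simp add: x ap_poly_Cons character_add[OF \<phi>] character_scale[OF \<phi> l])
qed

lemma tendsto_character:
  assumes \<phi>: "\<phi> \<in> characters" and X: "\<And>n. X n \<in> AP_semi \<Sigma>" "X \<longlonglongrightarrow> a" and a: "a \<in> AP_semi \<Sigma>"
  shows "(\<lambda>n. \<phi> (X n)) \<longlonglongrightarrow> \<phi> a"
proof -
  have "(\<lambda>n. norm (X n - a)) \<longlonglongrightarrow> 0"
    using X(2) by (simp add: LIM_zero tendsto_norm_zero)
  then have "(\<lambda>n. \<phi> (X n) - \<phi> a) \<longlonglongrightarrow> 0"
    by (rule Lim_null_comparison[rotated])
       (simp add: character_norm_diff_le[OF closed_subalgebra \<phi> X(1) a])
  then show ?thesis
    by (rule LIM_zero_cancel)
qed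

lemma character_eqI:
  assumes \<phi>: "\<phi> \<in> characters" and \<psi>: "\<psi> \<in> characters"
    and eq: "\<And>l. l \<in> \<Sigma> \<Longrightarrow> \<phi> (ap_exp l) = \<psi> (ap_exp l)"
  shows "\<phi> = \<psi>"
proof (rule extensionalityI)
  show "\<phi> \<in> extensional (AP_semi \<Sigma>)" "\<psi> \<in> extensional (AP_semi \<Sigma>)"
    using \<phi> \<psi> by (auto dest: character_extensional)
  fix a assume a: "a \<in> AP_semi \<Sigma>"
  then obtain X where X: "\<And>n. freqs (X n) \<subseteq> \<Sigma>" "(\<lambda>n. ap_poly (X n)) \<longlonglongrightarrow> a"
    by (rule AP_semi_limit) blast
  have "\<phi> (ap_poly (X n)) = \<psi> (ap_poly (X n))" for n
    using X(1)[of n] eq unfolding character_ap_poly[OF \<phi> X(1)] character_ap_poly[OF \<psi> X(1)]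
    by (intro freq_sum_cong) auto
  moreover have "(\<lambda>n. \<phi> (ap_poly (X n))) \<longlonglongrightarrow> \<phi> a" "(\<lambda>n. \<psi> (ap_poly (X n))) \<longlonglongrightarrow> \<psi> a"
    using X a \<phi> \<psi> by (auto intro!: tendsto_character ap_poly_in_AP_semi)
  ultimately show "\<phi> a = \<psi> a"
    using LIMSEQ_unique by simp
qed

text \<open>The bound makes the functional with \<open>e\<^sub>l \<mapsto> \<theta> l\<close> well defined on polynomials, since two
  representations of a polynomial differ by a representation of zero, and it makes it 1-Lipschitz.
  So it extends to the closure, where the algebraic identities persist by continuity.\<close>

lemma character_extension:
  fixes \<theta> :: "real \<Rightarrow> complex"
  assumes \<theta>_0: "\<theta> 0 = 1"
    and \<theta>_add: "\<And>l m. l \<in> \<Sigma> \<Longrightarrow> m \<in> \<Sigma> \<Longrightarrow> \<theta> (l + m) = \<theta> l * \<theta> m"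
    and bound: "\<And>xs. freqs xs \<subseteq> \<Sigma> \<Longrightarrow> cmod (freq_sum \<theta> xs) \<le> norm (ap_poly xs)"
  shows "\<exists>\<phi>\<in>characters. \<forall>l\<in>\<Sigma>. \<phi> (ap_exp l) = \<theta> l"
proof -
  let ?P = "ap_poly ` {xs. freqs xs \<subseteq> \<Sigma>}"
  have A: "AP_semi \<Sigma> = closure ?P"
    by (simp add: AP_semi_eq AP0_semi_eq)
  define f where "f a = freq_sum \<theta> (SOME xs. freqs xs \<subseteq> \<Sigma> \<and> a = ap_poly xs)" for a
  have lip: "cmod (freq_sum \<theta> xs - freq_sum \<theta> ys) \<le> norm (ap_poly xs - ap_poly ys)"
    if "freqs xs \<subseteq> \<Sigma>" "freqs ys \<subseteq> \<Sigma>" for xs ys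
  proof -
    let ?zs = "xs @ poly_scale (\<lambda>_. -1) ys"
    have "ap_poly ?zs = ap_poly xs - ap_poly ys"
      by (rule bcontfun_eqI) (simp add: ap_poly_append ap_poly_scale)
    moreover have "freq_sum \<theta> ?zs = freq_sum \<theta> xs - freq_sum \<theta> ys"
      unfolding freq_sum_append freq_sum_poly_scale freq_sum_mult_left by simp
    ultimately show ?thesis
      using bound[of ?zs] that by simp
  qed
  have f: "f (ap_poly xs) = freq_sum \<theta> xs" if xs: "freqs xs \<subseteq> \<Sigma>" for xs
  proof -
    define ys where "ys = (SOME ys. freqs ys \<subseteq> \<Sigma> \<and> ap_poly xs = ap_poly ys)"
    have "freqs ys \<subseteq> \<Sigma> \<and> ap_poly xs = ap_poly ys"
      unfolding ys_def by (rule someI[of _ xs]) (simp add: xs)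
    moreover have "f (ap_poly xs) = freq_sum \<theta> ys"
      by (simp only: f_def ys_def)
    ultimately show ?thesis
      using lip[of ys xs] xs by simp
  qed
  have "1-lipschitz_on ?P f"
    by (rule lipschitz_onI) (auto simp: f dist_norm lip)
  then have "uniformly_continuous_on ?P f"
    by (rule lipschitz_on_uniformly_continuous)
  then obtain g where g: "uniformly_continuous_on (closure ?P) g" and gf: "\<And>x. x \<in> ?P \<Longrightarrow> f x = g x"
    by (rule uniformly_continuous_on_extension_on_closure) (rule that)
  have g_poly: "g (ap_poly xs) = freq_sum \<theta> xs" if "freqs xs \<subseteq> \<Sigma>" for xs
    using f[OF that] gf[of "ap_poly xs"] that by simp
  have g_lim: "(\<lambda>n. g (ap_poly (X n))) \<longlonglongrightarrow> g a"
    if "\<And>n. freqs (X n) \<subseteq> \<Sigma>" "(\<lambda>n. ap_poly (X n)) \<longlonglongrightarrow> a" for X a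
  proof -
    have "a \<in> closure ?P"
      using AP_semi_limitI[OF that] by (simp only: A)
    moreover have "ap_poly (X n) \<in> closure ?P" for n
      using ap_poly_in_AP_semi[OF that(1)] by (simp only: A)
    ultimately show ?thesis
      using continuous_on_tendsto_compose[OF uniformly_continuous_imp_continuous[OF g] that(2)]
      by simp
  qed
  define \<phi> where "\<phi> = restrict g (AP_semi \<Sigma>)"
  have \<phi>_exp: "\<phi> (ap_exp l) = \<theta> l" if "l \<in> \<Sigma>" for l
    using g_poly[of "[(1, l)]"] that by (simp add: \<phi>_def ap_exp_in_AP_semi ap_poly_singleton)
  have closed: "a + b \<in> AP_semi \<Sigma>" "bc_mult a b \<in> AP_semi \<Sigma>" "bc_scale c a \<in> AP_semi \<Sigma>"
    if "a \<in> AP_semi \<Sigma>" "b \<in> AP_semi \<Sigma>" for a b c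
    using closed_subalgebra that by (auto simp: closed_subalgebra_def)
  have "\<phi> (a + b) = \<phi> a + \<phi> b \<and> \<phi> (bc_mult a b) = \<phi> a * \<phi> b \<and> \<phi> (bc_scale c a) = c * \<phi> a"
    if a: "a \<in> AP_semi \<Sigma>" and b: "b \<in> AP_semi \<Sigma>" for a b c
  proof -
    obtain X where X: "\<And>n. freqs (X n) \<subseteq> \<Sigma>" "(\<lambda>n. ap_poly (X n)) \<longlonglongrightarrow> a"
      using a by (rule AP_semi_limit) blast
    obtain Y where Y: "\<And>n. freqs (Y n) \<subseteq> \<Sigma>" "(\<lambda>n. ap_poly (Y n)) \<longlonglongrightarrow> b"
      using b by (rule AP_semi_limit) blast
    note gX = g_lim[OF X] and gY = g_lim[OF Y]
    have "g (a + b) = g a + g b"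
    proof (rule LIMSEQ_unique)
      show "(\<lambda>n. g (ap_poly (X n @ Y n))) \<longlonglongrightarrow> g (a + b)"
        using X Y by (intro g_lim) (auto simp: ap_poly_append intro!: tendsto_add)
      have "g (ap_poly (X n @ Y n)) = g (ap_poly (X n)) + g (ap_poly (Y n))" for n
        using X(1)[of n] Y(1)[of n] by (simp add: g_poly)
      then show "(\<lambda>n. g (ap_poly (X n @ Y n))) \<longlonglongrightarrow> g a + g b"
        using tendsto_add[OF gX gY] by simp
    qed
    moreover have "g (bc_mult a b) = g a * g b"
    proof (rule LIMSEQ_unique)
      have fr: "freqs (poly_mult (X n) (Y n)) \<subseteq> \<Sigma>" for n
        using X(1)[of n] Y(1)[of n] add_closed by (auto simp: freqs_poly_mult)
      show "(\<lambda>n. g (ap_poly (poly_mult (X n) (Y n)))) \<longlonglongrightarrow> g (bc_mult a b)"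
        using fr by (intro g_lim) (auto simp: ap_poly_mult intro!: tendsto_bc_mult X Y)
      have "g (ap_poly (poly_mult (X n) (Y n))) = g (ap_poly (X n)) * g (ap_poly (Y n))" for n
        unfolding g_poly[OF fr] g_poly[OF X(1)] g_poly[OF Y(1)]
        using X(1)[of n] Y(1)[of n] by (intro freq_sum_poly_mult \<theta>_add) auto
      then show "(\<lambda>n. g (ap_poly (poly_mult (X n) (Y n)))) \<longlonglongrightarrow> g a * g b"
        using tendsto_mult[OF gX gY] by simp
    qed
    moreover have "g (bc_scale c a) = c * g a"
    proof (rule LIMSEQ_unique)
      show "(\<lambda>n. g (ap_poly (poly_scale (\<lambda>_. c) (X n)))) \<longlonglongrightarrow> g (bc_scale c a)"
        using X by (intro g_lim) (auto simp: ap_poly_scale intro!: tendsto_bc_scale)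
      have "g (ap_poly (poly_scale (\<lambda>_. c) (X n))) = c * g (ap_poly (X n))" for n
        using X(1)[of n] by (simp add: g_poly freq_sum_poly_scale freq_sum_mult_left)
      then show "(\<lambda>n. g (ap_poly (poly_scale (\<lambda>_. c) (X n)))) \<longlonglongrightarrow> c * g a"
        using tendsto_mult_left[OF gX] by simp
    qed
    ultimately show ?thesis
      using a b by (simp add: \<phi>_def closed)
  qed
  moreover have "\<exists>a\<in>AP_semi \<Sigma>. \<phi> a \<noteq> 0"
    using \<phi>_exp[OF zero_mem] \<theta>_0 unit_mem by (intro bexI[of _ "ap_exp 0"]) simp_all
  ultimately have "\<phi> \<in> characters"
    unfolding nonzero_characters_def by (auto simp: \<phi>_def[THEN eq_reflection])
  then show ?thesis
    using \<phi>_exp by blast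
qed

text \<open>For \<open>r > 0\<close> the damped functional is \<open>\<phi>\<close> composed with the damping of polynomials, and both
  are contractive.  For \<open>r = 0\<close> the bound is obtained by letting \<open>r\<close> tend to \<open>0\<close>.\<close>

lemma damped_character_exists:
  assumes \<phi>: "\<phi> \<in> characters" and r: "r \<in> {0..1}"
  shows "\<exists>\<psi>\<in>characters. \<forall>l\<in>\<Sigma>. \<psi> (ap_exp l) = of_real (damping r l) * \<phi> (ap_exp l)"
proof (rule character_extension)
  show "of_real (damping r 0) * \<phi> (ap_exp 0) = 1"
    by (simp add: damping_def character_unit[OF \<phi> unit_mem])
next
  fix l m assume lm: "l \<in> \<Sigma>" "m \<in> \<Sigma>"
  have "\<phi> (ap_exp (l + m)) = \<phi> (ap_exp l) * \<phi> (ap_exp m)"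
  proof -
    have "ap_exp (l + m) = bc_mult (ap_exp l) (ap_exp m)"
      by (rule bcontfun_eqI) (simp add: algebra_simps exp_add)
    then show ?thesis
      using lm by (simp add: character_mult[OF \<phi>] ap_exp_in_AP_semi)
  qed
  then show "of_real (damping r (l + m)) * \<phi> (ap_exp (l + m)) =
      of_real (damping r l) * \<phi> (ap_exp l) * (of_real (damping r m) * \<phi> (ap_exp m))"
    using lm nonneg by (subst damping_add) auto
next
  fix xs assume xs: "freqs xs \<subseteq> \<Sigma>"
  let ?f = "\<lambda>r. freq_sum (\<lambda>l. of_real (damping r l) * \<phi> (ap_exp l)) xs"
  have "continuous_on {0..1} ?f"
    using xs
  proof (induction xs)
    case (Cons x xs)
    then show ?case
      using nonneg by (cases x) (auto intro!: continuous_intros continuous_on_damping)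
  qed simp
  moreover have "cmod (?f s) \<le> norm (ap_poly xs)" if s: "s \<in> {0<..1}" for s
  proof -
    let ?ys = "poly_scale (\<lambda>l. of_real (damping s l)) xs"
    have ys: "freqs ?ys \<subseteq> \<Sigma>"
      using xs by simp
    have "?f s = \<phi> (ap_poly ?ys)"
      unfolding character_ap_poly[OF \<phi> ys] freq_sum_poly_scale by simp
    also have "cmod \<dots> \<le> norm (ap_poly ?ys)"
      by (rule character_norm_le[OF closed_subalgebra \<phi> ap_poly_in_AP_semi[OF ys]])
    also have "\<dots> \<le> norm (ap_poly xs)"
      using xs nonneg s by (intro norm_damped_poly_le) auto
    finally show ?thesis .
  qed
  moreover have "closure {0<..1::real} = {0..1}"
    by simp
  ultimately show "cmod (?f r) \<le> norm (ap_poly xs)"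
    using r by (intro continuous_on_closure_norm_le[of "{0<..1}" ?f]) auto
qed

text \<open>The choice is unambiguous by \<open>character_eqI\<close>.\<close>

definition damped_character :: "real \<Rightarrow> ((real \<Rightarrow>\<^sub>C complex) \<Rightarrow> complex) \<Rightarrow> ((real \<Rightarrow>\<^sub>C complex) \<Rightarrow> complex)"
  where "damped_character r \<phi> =
    (SOME \<psi>. \<psi> \<in> characters \<and> (\<forall>l\<in>\<Sigma>. \<psi> (ap_exp l) = of_real (damping r l) * \<phi> (ap_exp l)))"

lemma damped_character:
  assumes "\<phi> \<in> characters" "r \<in> {0..1}"
  shows "damped_character r \<phi> \<in> characters"
    and "l \<in> \<Sigma> \<Longrightarrow> damped_character r \<phi> (ap_exp l) = of_real (damping r l) * \<phi> (ap_exp l)"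
  using someI_ex[OF damped_character_exists[OF assms, unfolded Bex_def]]
  unfolding damped_character_def[symmetric] by blast+

lemma damped_character_1: "\<phi> \<in> characters \<Longrightarrow> damped_character 1 \<phi> = \<phi>"
  by (rule character_eqI) (simp_all add: damped_character)

lemma damped_character_0:
  assumes "\<phi> \<in> characters" "\<psi> \<in> characters"
  shows "damped_character 0 \<phi> = damped_character 0 \<psi>"
  using assms by (intro character_eqI)
    (simp_all add: damped_character damping_0 character_unit[OF _ unit_mem])

text \<open>On polynomials joint continuity is explicit.  For other elements of the algebra it follows by
  uniform approximation, because all characters are contractive.\<close>

lemma continuous_map_damped_character:
  "continuous_map (prod_topology (top_of_set {0..1}) (maximal_ideal_space (AP_semi \<Sigma>)))
     (maximal_ideal_space (AP_semi \<Sigma>)) (\<lambda>(r, \<phi>). damped_character r \<phi>)"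
proof -
  let ?M = "maximal_ideal_space (AP_semi \<Sigma>)"
  let ?Z = "prod_topology (top_of_set {0..1}) ?M"
  let ?h = "\<lambda>(r, \<phi>). damped_character r \<phi>"
  have top: "topspace ?Z = {0..1} \<times> characters"
    by (simp add: topspace_maximal_ideal_space)
  have h_char: "?h z \<in> characters" if "z \<in> topspace ?Z" for z
    using that damped_character(1) unfolding top by auto
  have eval: "continuous_map ?M euclidean (\<lambda>\<phi>. \<phi> a)" if "a \<in> AP_semi \<Sigma>" for a
    unfolding maximal_ideal_space_def
    using that by (intro continuous_map_from_subtopology continuous_map_product_projection)
  have poly: "continuous_map ?Z euclidean (\<lambda>z. ?h z (ap_poly xs))" if "freqs xs \<subseteq> \<Sigma>" for xs
  proof -
    have cont: "continuous_map ?Z euclidean (\<lambda>z. freq_sum (\<lambda>l. of_real (damping (fst z) l) * snd z (ap_exp l)) xs)"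
      using that
    proof (induction xs)
      case (Cons x xs)
      obtain c l where x: "x = (c, l)"
        by fastforce
      have l: "l \<in> \<Sigma>" "l \<ge> 0"
        using Cons.prems nonneg by (auto simp: x)
      have "continuous_map (top_of_set {0..1}) euclidean (\<lambda>r. complex_of_real (damping r l))"
        using continuous_on_damping[OF l(2)] by (simp add: continuous_on_of_real)
      then have "continuous_map ?Z euclidean (\<lambda>z. complex_of_real (damping (fst z) l))"
        by (rule continuous_map_compose[OF continuous_map_fst, unfolded o_def])
      moreover have "continuous_map ?Z euclidean (\<lambda>z. snd z (ap_exp l))"
        using continuous_map_compose[OF continuous_map_snd eval[OF ap_exp_in_AP_semi[OF l(1)]]]
        by (simp add: o_def)
      ultimately show ?case
        using Cons by (auto simp: x continuous_map_atin intro!: tendsto_add tendsto_mult)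
    qed simp
    have eq: "?h z (ap_poly xs) = freq_sum (\<lambda>l. of_real (damping (fst z) l) * snd z (ap_exp l)) xs"
      if z: "z \<in> topspace ?Z" for z
    proof -
      obtain r \<phi> where r: "z = (r, \<phi>)" "r \<in> {0..1}" "\<phi> \<in> characters"
        using z unfolding top by auto
      show ?thesis
        using \<open>freqs xs \<subseteq> \<Sigma>\<close> damped_character[OF r(3,2)]
        by (simp add: r(1) character_ap_poly) (intro freq_sum_cong; auto)
    qed
    show ?thesis
      by (rule continuous_map_eq[OF cont]) (rule eq[symmetric])
  qed
  have "continuous_map ?Z euclidean (\<lambda>z. ?h z a)" if a: "a \<in> AP_semi \<Sigma>" for a
  proof -
    obtain X where X: "\<And>n. freqs (X n) \<subseteq> \<Sigma>" "(\<lambda>n. ap_poly (X n)) \<longlonglongrightarrow> a"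
      using a by (rule AP_semi_limit) blast
    have "continuous_map ?Z Met_TC.mtopology (\<lambda>z. ?h z a)"
    proof (rule Met_TC.continuous_map_uniform_limit)
      show "\<forall>\<^sub>F n in sequentially. continuous_map ?Z Met_TC.mtopology (\<lambda>z. ?h z (ap_poly (X n)))"
        using poly[OF X(1)] by simp
      fix e :: real assume "e > 0"
      then have "\<forall>\<^sub>F n in sequentially. norm (ap_poly (X n) - a) < e"
        using tendstoD[OF X(2)] by (simp add: dist_norm)
      then show "\<forall>\<^sub>F n in sequentially. \<forall>z\<in>topspace ?Z. ?h z a \<in> UNIV \<and> dist (?h z (ap_poly (X n))) (?h z a) < e"
      proof eventually_elim
        case (elim n)
        show ?case
          using elim character_norm_diff_le[OF closed_subalgebra h_char ap_poly_in_AP_semi[OF X(1)] a]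
          by (auto simp: dist_norm intro: le_less_trans)
      qed
    qed simp
    then show ?thesis
      by simp
  qed
  then show ?thesis
    using h_char character_extensional
    unfolding maximal_ideal_space_def[of "AP_semi \<Sigma>"] continuous_map_in_subtopology continuous_map_componentwise
    by (auto simp flip: maximal_ideal_space_def)
qed

text \<open>As \<open>r\<close> grows from \<open>0\<close> to \<open>1\<close>, the damping runs from a constant map to the identity.\<close>

lemma contractible_maximal_ideal_space: "contractible_space (maximal_ideal_space (AP_semi \<Sigma>))"
proof -
  let ?M = "maximal_ideal_space (AP_semi \<Sigma>)"
  let ?a = "damped_character 0 (SOME \<phi>. \<phi> \<in> characters)"
  have const: "damped_character 0 \<phi> = ?a" if "\<phi> \<in> characters" for \<phi>
    using that someI[of "\<lambda>\<phi>. \<phi> \<in> characters", OF that] by (rule damped_character_0)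
  have "homotopic_with (\<lambda>_. True) ?M ?M (\<lambda>_. ?a) id"
    unfolding homotopic_with[where P = "\<lambda>_. True", simplified]
    using continuous_map_damped_character const damped_character_1
    by (intro exI[of _ "\<lambda>(r, \<phi>). damped_character r \<phi>"]) (simp add: topspace_maximal_ideal_space)
  then show ?thesis
    unfolding contractible_space_def using homotopic_with_sym by blast
qed

end

theorem corollary1p2:
  fixes \<Sigma> :: "real set" and m :: nat
  assumes "\<Sigma> \<subseteq> {0..}"
    and "\<And>l \<mu>. l \<in> \<Sigma> \<Longrightarrow> \<mu> \<in> \<Sigma> \<Longrightarrow> l + \<mu> \<in> \<Sigma>"
    and "0 \<in> \<Sigma>"
    and "m \<ge> 1"
  shows "trivial_group (cech_cohomology_group m (maximal_ideal_space (AP_semi \<Sigma>)))"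
proof -
  interpret additive_frequencies \<Sigma>
    by unfold_locales (use assms in auto)
  have "compact_space (maximal_ideal_space (AP_semi \<Sigma>))"
    using closed_subalgebra unit_mem by (rule compact_maximal_ideal_space)
  then show ?thesis
    using contractible_maximal_ideal_space assms(4) by (rule trivial_cech_cohomology_compact_contractible)
qed

end
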